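(* Let $(\mathbf{C},\mathcal{M})$ be a geometric $\mathcal{M}$-category. Then there is a Grothendieck topology on $\mathbf{C}$ whose basic covers of $C\in\mathbf{C}$ are given by the families of the form $$\Big\{a_i\colon C_i\to C\;\Big|\;a_i\in\mathcal{M},\ \bigvee_{i\in I}a_i=1\text{ in }\mathsf{Sub}_{\mathcal{M}}(C)\Big\}_{i\in I}$$ (that is, these families form a basis for a Grothendieck topology). Equivalently, $\{a_i\colon C_i\to C\}_{i\in I}$ is a basic cover of $C$ if and only if $C$, with the maps $a_i$, is the colimit of the matching diagram for some family of $\mathcal{M}$-subobjects $\{m_i\colon C_i\to A\}_{i\in I}$.
   Context: All categories are locally small; families are indexed by sets. Restriction categories. A restriction category is a category $\mathbf{X}$ with an assignment $f\mapsto \bar f$, $\mathbf{X}(A,B)\to\mathbf{X}(A,A)$, satisfying, for suitable maps, (R1) $f\bar f=f$; (R2) $\bar g\bar f=\bar f\bar g$; (R3) $\overline{g\bar f}=\bar g\bar f$; (R4) $\bar h f=f\,\overline{hf}$. Hom-sets are partially ordered by $f\le g$ iff $f=g\bar f$. Maps $f,g\in\mathbf{X}(A,B)$ are compatible if $f\bar g=g\bar f$; a set of parallel maps is compatible if its elements are pairwise compatible. A join restriction category is a restriction category in which every compatible set $S\subset\mathbf{X}(A,B)$ has a join $\bigvee_{s\in S}s$ in the poset $\mathbf{X}(A,B)$ satisfying (J1) $\overline{\bigvee_{s\in S}s}=\bigvee_{s\in S}\bar s$ and (J2) $(\bigvee_{s\in S}s)\circ g=\bigvee_{s\in S}(s\circ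 g)$. $\mathcal{M}$-categories. An $\mathcal{M}$-category $(\mathbf{C},\mathcal{M})$ is a category $\mathbf{C}$ with a family $\mathcal{M}$ of monics containing all isomorphisms, closed under composition, and such that the pullback of any $m\in\mathcal{M}$ along any map exists and is in $\mathcal{M}$. $\mathsf{Sub}_{\mathcal{M}}(C)$ is the poset (assumed small) of $\mathcal{M}$-subobjects of $C$, i.e. isomorphism classes of maps in $\mathcal{M}$ with codomain $C$, ordered by $m\le n$ iff $m$ factors through $n$. $\mathsf{Par}(\mathbf{C},\mathcal{M})$ has the objects of $\mathbf{C}$; its morphisms $A\to B$ are isomorphism classes of spans $(m,f)$ with $m\colon C\to A$ in $\mathcal{M}$ and $f\colon C\to B$, composed by pullback; it is a restriction category with $\overline{(m,f)}=(m,m)$. $(\mathbf{C},\mathcal{M})$ is geometric if $\mathsf{Par}(\mathbf{C},\mathcal{M})$ is a join restriction category. Matching diagram. For a family $\{m_i\colon A_i\to A\}_{i\in I}$ of $\mathcal{M}$-subobjects, let $A_iA_j$ be the pullback of $m_i$ and $m_j$, with projections $m_{ji}\colon A_iA_j\to A_i$ and $m_{ij}\colon A_iA_j\to A_j$. The matching diagram is the diagram on the objects $\{A_i\}\cup\{A_iA_j\mid i\neq j\}$ with morphisms the $m_{ij}$. When $(\mathbf{C},\mathcal{M})$ is geometric, its colimit $\bigcup_{i\in I}A_i$ exists and the induced map $\bigvee_{i\in I}m_i\colon\bigcup_{i\in I}A_i\to A$ is in $\mathcal{M}$ and is the join of the $m_i$ in $\mathsf{Sub}_{\mathcal{M}}(A)$.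 *)

theory Defs
  imports "HOL-Algebra.Order"
begin

record ('o, 'a) cat_struct =
  Ob :: "'o set"
  Ar :: "'a set"
  Dom :: "'a \<Rightarrow> 'o"
  Cod :: "'a \<Rightarrow> 'o"
  Ident :: "'o \<Rightarrow> 'a"
  Comp :: "'a \<Rightarrow> 'a \<Rightarrow> 'a"  (infixl "\<cdot>\<index>" 70)

text \<open>Composition is in applicative order and is meaningful only for composable arrows:
  \<open>g \<cdot> f\<close> requires \<open>Cod f = Dom g\<close>.\<close>

definition hom :: "('o, 'a) cat_struct \<Rightarrow> 'o \<Rightarrow> 'o \<Rightarrow> 'a set" where
  "hom C A B = {f \<in> Ar C. Dom C f = A \<and> Cod C f = B}"

locale category =
  fixes C :: "('o, 'a) cat_struct" (structure)
  assumes dom_cod: "f \<in> Ar C \<Longrightarrow> Dom C f \<in> Ob C \<and> Cod C f \<in> Ob C"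
    and ident_hom: "A \<in> Ob C \<Longrightarrow> Ident C A \<in> hom C A A"
    and comp_hom: "\<lbrakk>f \<in> hom C A B; g \<in> hom C B D\<rbrakk> \<Longrightarrow> g \<cdot> f \<in> hom C A D"
    and comp_ident: "f \<in> hom C A B \<Longrightarrow> f \<cdot> Ident C A = f"
    and ident_comp: "f \<in> hom C A B \<Longrightarrow> Ident C B \<cdot> f = f"
    and comp_assoc: "\<lbrakk>f \<in> hom C A B; g \<in> hom C B D; h \<in> hom C D E\<rbrakk>
      \<Longrightarrow> (h \<cdot> g) \<cdot> f = h \<cdot> (g \<cdot> f)"

definition is_iso :: "('o, 'a) cat_struct \<Rightarrow> 'a \<Rightarrow> bool" where
  "is_iso C f \<longleftrightarrow> f \<in> Ar C \<and>
    (\<exists>g \<in> hom C (Cod C f) (Dom C f).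
       g \<cdot>\<^bsub>C\<^esub> f = Ident C (Dom C f) \<and> f \<cdot>\<^bsub>C\<^esub> g = Ident C (Cod C f))"

definition is_monic :: "('o, 'a) cat_struct \<Rightarrow> 'a \<Rightarrow> bool" where
  "is_monic C m \<longleftrightarrow> m \<in> Ar C \<and>
    (\<forall>X \<in> Ob C. \<forall>f \<in> hom C X (Dom C m). \<forall>g \<in> hom C X (Dom C m).
       m \<cdot>\<^bsub>C\<^esub> f = m \<cdot>\<^bsub>C\<^esub> g \<longrightarrow> f = g)"

text \<open>\<open>is_pullback C f g p q\<close>: the square \<open>f \<cdot> p = g \<cdot> q\<close> is a pullback, where
  \<open>p\<close> is the projection to \<open>Dom f\<close> and \<open>q\<close> the projection to \<open>Dom g\<close>.\<close>

definition is_pullback :: "('o, 'a) cat_struct \<Rightarrow> 'a \<Rightarrow> 'a \<Rightarrow> 'a \<Rightarrow> 'a \<Rightarrow> bool" where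
  "is_pullback C f g p q \<longleftrightarrow>
    f \<in> Ar C \<and> g \<in> Ar C \<and> Cod C f = Cod C g \<and>
    p \<in> hom C (Dom C p) (Dom C f) \<and> q \<in> hom C (Dom C p) (Dom C g) \<and>
    f \<cdot>\<^bsub>C\<^esub> p = g \<cdot>\<^bsub>C\<^esub> q \<and>
    (\<forall>X \<in> Ob C. \<forall>u \<in> hom C X (Dom C f). \<forall>v \<in> hom C X (Dom C g).
       f \<cdot>\<^bsub>C\<^esub> u = g \<cdot>\<^bsub>C\<^esub> v \<longrightarrow>
       (\<exists>!h. h \<in> hom C X (Dom C p) \<and> p \<cdot>\<^bsub>C\<^esub> h = u \<and> q \<cdot>\<^bsub>C\<^esub> h = v))"

record ('v, 'e, 'o, 'a) diagram =
  Verts :: "'v set"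
  Edges :: "'e set"
  Source :: "'e \<Rightarrow> 'v"
  Target :: "'e \<Rightarrow> 'v"
  ObMap :: "'v \<Rightarrow> 'o"
  ArMap :: "'e \<Rightarrow> 'a"

definition is_diagram :: "('o, 'a) cat_struct \<Rightarrow> ('v, 'e, 'o, 'a) diagram \<Rightarrow> bool" where
  "is_diagram C D \<longleftrightarrow>
    (\<forall>v \<in> Verts D. ObMap D v \<in> Ob C) \<and>
    (\<forall>e \<in> Edges D. Source D e \<in> Verts D \<and> Target D e \<in> Verts D \<and>
       ArMap D e \<in> hom C (ObMap D (Source D e)) (ObMap D (Target D e)))"

definition is_cocone ::
  "('o, 'a) cat_struct \<Rightarrow> ('v, 'e, 'o, 'a) diagram \<Rightarrow> 'o \<Rightarrow> ('v \<Rightarrow> 'a) \<Rightarrow> bool" where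
  "is_cocone C D X l \<longleftrightarrow> X \<in> Ob C \<and>
    (\<forall>v \<in> Verts D. l v \<in> hom C (ObMap D v) X) \<and>
    (\<forall>e \<in> Edges D. l (Target D e) \<cdot>\<^bsub>C\<^esub> ArMap D e = l (Source D e))"

definition is_colimit ::
  "('o, 'a) cat_struct \<Rightarrow> ('v, 'e, 'o, 'a) diagram \<Rightarrow> 'o \<Rightarrow> ('v \<Rightarrow> 'a) \<Rightarrow> bool" where
  "is_colimit C D X l \<longleftrightarrow> is_diagram C D \<and> is_cocone C D X l \<and>
    (\<forall>Y l'. is_cocone C D Y l' \<longrightarrow>
       (\<exists>!h. h \<in> hom C X Y \<and> (\<forall>v \<in> Verts D. h \<cdot>\<^bsub>C\<^esub> l v = l' v)))"

locale restriction_category = category X for X :: "('o, 'a) cat_struct" (structure) +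
  fixes rst :: "'a \<Rightarrow> 'a"
  assumes rst_hom: "f \<in> hom X A B \<Longrightarrow> rst f \<in> hom X A A"
    and R1: "f \<in> hom X A B \<Longrightarrow> f \<cdot> rst f = f"
    and R2: "\<lbrakk>f \<in> hom X A B; g \<in> hom X A D\<rbrakk> \<Longrightarrow> rst g \<cdot> rst f = rst f \<cdot> rst g"
    and R3: "\<lbrakk>f \<in> hom X A B; g \<in> hom X A D\<rbrakk> \<Longrightarrow> rst (g \<cdot> rst f) = rst g \<cdot> rst f"
    and R4: "\<lbrakk>f \<in> hom X A B; h \<in> hom X B D\<rbrakk> \<Longrightarrow> rst h \<cdot> f = f \<cdot> rst (h \<cdot> f)"

definition hom_order ::
  "('o, 'a) cat_struct \<Rightarrow> ('a \<Rightarrow> 'a) \<Rightarrow> 'o \<Rightarrow> 'o \<Rightarrow> 'a gorder" where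
  "hom_order X rst A B =
    \<lparr>carrier = hom X A B, eq = (=), le = (\<lambda>f g. f = g \<cdot>\<^bsub>X\<^esub> rst f)\<rparr>"

definition compatible_set :: "('o, 'a) cat_struct \<Rightarrow> ('a \<Rightarrow> 'a) \<Rightarrow> 'a set \<Rightarrow> bool" where
  "compatible_set X rst S \<longleftrightarrow> (\<forall>f \<in> S. \<forall>g \<in> S. f \<cdot>\<^bsub>X\<^esub> rst g = g \<cdot>\<^bsub>X\<^esub> rst f)"

definition is_join :: "'a gorder \<Rightarrow> 'a set \<Rightarrow> 'a \<Rightarrow> bool" where
  "is_join L S j \<longleftrightarrow> least L j (Upper L S)"

locale join_restriction_category = restriction_category X rst
  for X :: "('o, 'a) cat_struct" (structure) and rst :: "'a \<Rightarrow> 'a" +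
  assumes joins: "\<lbrakk>A \<in> Ob X; B \<in> Ob X; S \<subseteq> hom X A B; compatible_set X rst S\<rbrakk>
    \<Longrightarrow> \<exists>j. is_join (hom_order X rst A B) S j \<and>
            is_join (hom_order X rst A A) (rst ` S) (rst j) \<and>
            (\<forall>A' \<in> Ob X. \<forall>g \<in> hom X A' A.
               is_join (hom_order X rst A' B) ((\<lambda>s. s \<cdot> g) ` S) (j \<cdot> g))"

locale M_category = category C for C :: "('o, 'a) cat_struct" (structure) +
  fixes M :: "'a set"
  assumes M_monic: "m \<in> M \<Longrightarrow> is_monic C m"
    and M_iso: "is_iso C f \<Longrightarrow> f \<in> M"
    and M_comp: "\<lbrakk>m \<in> M; n \<in> M; Cod C m = Dom C n\<rbrakk> \<Longrightarrow> n \<cdot> m \<in> M"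
    and M_pullback: "\<lbrakk>m \<in> M; f \<in> Ar C; Cod C f = Cod C m\<rbrakk>
      \<Longrightarrow> \<exists>p q. is_pullback C m f p q \<and> q \<in> M"

definition subobject :: "('o, 'a) cat_struct \<Rightarrow> 'a set \<Rightarrow> 'a \<Rightarrow> 'a set" where
  "subobject C M m =
    {n \<in> M. \<exists>h \<in> hom C (Dom C n) (Dom C m). is_iso C h \<and> n = m \<cdot>\<^bsub>C\<^esub> h}"

definition Sub :: "('o, 'a) cat_struct \<Rightarrow> 'a set \<Rightarrow> 'o \<Rightarrow> 'a set gorder" where
  "Sub C M X =
    \<lparr>carrier = subobject C M ` {m \<in> M. Cod C m = X},
     eq = (=),
     le = (\<lambda>\<alpha> \<beta>. \<exists>m \<in> \<alpha>. \<exists>n \<in> \<beta>. \<exists>k \<in> hom C (Dom C m) (Dom C n). m = n \<cdot>\<^bsub>C\<^esub> k)\<rparr>"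

definition spans :: "('o, 'a) cat_struct \<Rightarrow> 'a set \<Rightarrow> ('a \<times> 'a) set" where
  "spans C M = {(m, f). m \<in> M \<and> f \<in> Ar C \<and> Dom C f = Dom C m}"

definition span_class :: "('o, 'a) cat_struct \<Rightarrow> 'a set \<Rightarrow> 'a \<times> 'a \<Rightarrow> ('a \<times> 'a) set" where
  "span_class C M = (\<lambda>(m, f).
    {(m', f') \<in> spans C M. \<exists>h \<in> hom C (Dom C m') (Dom C m).
       is_iso C h \<and> m' = m \<cdot>\<^bsub>C\<^esub> h \<and> f' = f \<cdot>\<^bsub>C\<^esub> h})"

text \<open>The composite of two classes collects the composites of all representatives along
  all pullbacks; as pullbacks are closed under isomorphism, this set is
  exactly one isomorphism class. Likewise, the set of all \<open>(m, m)\<close> with \<open>(m, f)\<close> in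
  a given class is the whole class of any one of these spans.\<close>

definition Par :: "('o, 'a) cat_struct \<Rightarrow> 'a set \<Rightarrow> ('o, ('a \<times> 'a) set) cat_struct" where
  "Par C M =
    \<lparr>Ob = Ob C,
     Ar = span_class C M ` spans C M,
     Dom = (\<lambda>\<phi>. the_elem ((\<lambda>(m, f). Cod C m) ` \<phi>)),
     Cod = (\<lambda>\<phi>. the_elem ((\<lambda>(m, f). Cod C f) ` \<phi>)),
     Ident = (\<lambda>A. span_class C M (Ident C A, Ident C A)),
     Comp = (\<lambda>\<psi> \<phi>. {(m \<cdot>\<^bsub>C\<^esub> q, g \<cdot>\<^bsub>C\<^esub> p) | m f n g p q.
       (m, f) \<in> \<phi> \<and> (n, g) \<in> \<psi> \<and> is_pullback C n f p q})\<rparr>"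

definition Par_rst :: "('a \<times> 'a) set \<Rightarrow> ('a \<times> 'a) set" where
  "Par_rst \<phi> = (\<lambda>(m, f). (m, m)) ` \<phi>"

locale geometric_M_category = M_category C M
  for C :: "('o, 'a) cat_struct" (structure) and M :: "'a set" +
  assumes geometric: "join_restriction_category (Par C M) Par_rst"

text \<open>A family indexed by a set \<open>I\<close> is a function of which only the values on \<open>I\<close>
  matter. A choice of the pullbacks of \<open>m i\<close> and \<open>m j\<close> is given by
  its projections \<open>pm j i\<close> to \<open>Dom (m i)\<close> and \<open>pm i j\<close> to \<open>Dom (m j)\<close>. The overlap of
  \<open>i\<close> and \<open>j\<close> is a single vertex of the matching diagram, labelled by the unordered
  pair, and the edge \<open>(i, j)\<close> is the projection \<open>pm i j\<close> from it to \<open>Dom (m j)\<close>.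
  The object at that vertex is the common domain of \<open>pm i j\<close> and \<open>pm j i\<close>.\<close>

definition pullback_choice ::
  "('o, 'a) cat_struct \<Rightarrow> 'i set \<Rightarrow> ('i \<Rightarrow> 'a) \<Rightarrow> ('i \<Rightarrow> 'i \<Rightarrow> 'a) \<Rightarrow> bool" where
  "pullback_choice C I m pm \<longleftrightarrow>
    (\<forall>i \<in> I. \<forall>j \<in> I. i \<noteq> j \<longrightarrow> is_pullback C (m i) (m j) (pm j i) (pm i j))"

datatype 'i mvertex = Piece 'i | Overlap "'i set"

definition matching_diagram ::
  "('o, 'a) cat_struct \<Rightarrow> 'i set \<Rightarrow> ('i \<Rightarrow> 'a) \<Rightarrow> ('i \<Rightarrow> 'i \<Rightarrow> 'a)
    \<Rightarrow> ('i mvertex, 'i \<times> 'i, 'o, 'a) diagram" where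
  "matching_diagram C I m pm =
    \<lparr>Verts = {Piece i | i. i \<in> I} \<union> {Overlap {i, j} | i j. i \<in> I \<and> j \<in> I \<and> i \<noteq> j},
     Edges = {(i, j). i \<in> I \<and> j \<in> I \<and> i \<noteq> j},
     Source = (\<lambda>(i, j). Overlap {i, j}),
     Target = (\<lambda>(i, j). Piece j),
     ObMap = (\<lambda>v. case v of
        Piece i \<Rightarrow> Dom C (m i)
      | Overlap e \<Rightarrow> (THE P. \<exists>i j. i \<noteq> j \<and> e = {i, j} \<and> P = Dom C (pm i j))),
     ArMap = (\<lambda>(i, j). pm i j)\<rparr>"

text \<open>The legs at the overlaps are determined by those at the pieces, so only the latter
  are mentioned.\<close>

definition colimit_of_matching_diagram ::
  "('o, 'a) cat_struct \<Rightarrow> 'i set \<Rightarrow> ('i \<Rightarrow> 'a) \<Rightarrow> 'o \<Rightarrow> ('i \<Rightarrow> 'a) \<Rightarrow> bool" where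
  "colimit_of_matching_diagram C I m X a \<longleftrightarrow>
    (\<exists>pm l. pullback_choice C I m pm \<and> is_colimit C (matching_diagram C I m pm) X l \<and>
       (\<forall>i \<in> I. l (Piece i) = a i))"

definition sieve :: "('o, 'a) cat_struct \<Rightarrow> 'o \<Rightarrow> 'a set \<Rightarrow> bool" where
  "sieve C X S \<longleftrightarrow> S \<subseteq> {f \<in> Ar C. Cod C f = X} \<and>
    (\<forall>f \<in> S. \<forall>g \<in> Ar C. Cod C g = Dom C f \<longrightarrow> f \<cdot>\<^bsub>C\<^esub> g \<in> S)"

definition pull_sieve :: "('o, 'a) cat_struct \<Rightarrow> 'a \<Rightarrow> 'a set \<Rightarrow> 'a set" where
  "pull_sieve C h S = {g \<in> Ar C. Cod C g = Dom C h \<and> h \<cdot>\<^bsub>C\<^esub> g \<in> S}"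

definition grothendieck_topology :: "('o, 'a) cat_struct \<Rightarrow> ('o \<Rightarrow> 'a set set) \<Rightarrow> bool" where
  "grothendieck_topology C J \<longleftrightarrow>
    (\<forall>X \<in> Ob C. \<forall>S \<in> J X. sieve C X S) \<and>
    (\<forall>X \<in> Ob C. {f \<in> Ar C. Cod C f = X} \<in> J X) \<and>
    (\<forall>X \<in> Ob C. \<forall>S \<in> J X. \<forall>h \<in> Ar C. Cod C h = X \<longrightarrow> pull_sieve C h S \<in> J (Dom C h)) \<and>
    (\<forall>X \<in> Ob C. \<forall>S \<in> J X. \<forall>R. sieve C X R \<and> (\<forall>h \<in> S. pull_sieve C h R \<in> J (Dom C h))
       \<longrightarrow> R \<in> J X)"

text \<open>The families in a basis are indexed by subsets of one type \<open>'i\<close>. The composite of a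
  cover indexed by \<open>I\<close> with covers indexed by \<open>J i\<close> is naturally indexed by
  \<open>Sigma I J\<close>; it is transported to an index set \<open>L :: 'i set\<close> along a bijection.
  Every set embeds into an infinite type, and for infinite \<open>'i\<close> such an \<open>L\<close> always
  exists, so infinite index types lose no families.\<close>

definition grothendieck_basis ::
  "('o, 'a) cat_struct \<Rightarrow> ('o \<Rightarrow> ('i set \<times> ('i \<Rightarrow> 'a)) set) \<Rightarrow> bool" where
  "grothendieck_basis C K \<longleftrightarrow>
    (\<forall>X \<in> Ob C. \<forall>(I, a) \<in> K X. \<forall>i \<in> I. a i \<in> Ar C \<and> Cod C (a i) = X) \<and>
    (\<forall>X \<in> Ob C. \<forall>i a. is_iso C (a i) \<and> Cod C (a i) = X \<longrightarrow> ({i}, a) \<in> K X) \<and>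
    (\<forall>X \<in> Ob C. \<forall>(I, a) \<in> K X. \<forall>g \<in> Ar C. Cod C g = X \<longrightarrow>
       (\<forall>i \<in> I. \<exists>p q. is_pullback C (a i) g p q) \<and>
       (\<forall>p b. (\<forall>i \<in> I. is_pullback C (a i) g (p i) (b i)) \<longrightarrow> (I, b) \<in> K (Dom C g))) \<and>
    (\<forall>X \<in> Ob C. \<forall>(I, a) \<in> K X. \<forall>J b. (\<forall>i \<in> I. (J i, b i) \<in> K (Dom C (a i))) \<longrightarrow>
       (\<forall>L \<sigma> c. bij_betw \<sigma> L (Sigma I J) \<and>
          (\<forall>l \<in> L. \<forall>i j. \<sigma> l = (i, j) \<longrightarrow> c l = a i \<cdot>\<^bsub>C\<^esub> b i j) \<longrightarrow>
          (L, c) \<in> K X))"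

definition is_basis_for ::
  "('o, 'a) cat_struct \<Rightarrow> ('o \<Rightarrow> ('i set \<times> ('i \<Rightarrow> 'a)) set) \<Rightarrow> ('o \<Rightarrow> 'a set set) \<Rightarrow> bool" where
  "is_basis_for C K J \<longleftrightarrow> grothendieck_basis C K \<and>
    (\<forall>X \<in> Ob C. J X = {S. sieve C X S \<and> (\<exists>(I, a) \<in> K X. a ` I \<subseteq> S)})"

definition basic_covers ::
  "('o, 'a) cat_struct \<Rightarrow> 'a set \<Rightarrow> 'o \<Rightarrow> ('i set \<times> ('i \<Rightarrow> 'a)) set" where
  "basic_covers C M X =
    {(I, a). (\<forall>i \<in> I. a i \<in> M \<and> Cod C (a i) = X) \<and>
       is_join (Sub C M X) ((\<lambda>i. subobject C M (a i)) ` I) (subobject C M (Ident C X))}"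

end

theory Submission
  imports Defs
begin

text \<open>In \<open>Par(C, M)\<close> one has \<open>(m, f) \<le> (n, g)\<close> iff \<open>m = n k\<close> and \<open>f = g k\<close> for some \<open>k\<close>. So a join of
  compatible spans \<open>(m\<^sub>i, f\<^sub>i)\<close> is a span \<open>(n, h)\<close>, where by (J1) \<open>n\<close> is the join of the subobjects
  \<open>m\<^sub>i\<close>, and \<open>h\<close> is the unique common extension of the \<open>f\<^sub>i\<close> along \<open>m\<^sub>i = n b\<^sub>i\<close>: the domain of \<open>n\<close> is
  the colimit of the matching diagram. Applying (J2) to the total map \<open>(1, g)\<close> shows that covering
  families are stable under pullback along \<open>g\<close>. They compose because an upper bound of all
  \<open>a\<^sub>i b\<^sub>i\<^sub>j\<close>, pulled back along \<open>a\<^sub>i\<close>, is an upper bound of the cover \<open>(b\<^sub>i\<^sub>j)\<^sub>j\<close>, hence invertible.\<close>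

section \<open>Categories and pullbacks\<close>

text \<open>The axioms of a geometric category speak of isomorphism classes of spans, the conclusion
  of individual arrows. The relations \<open>factors\<close>, \<open>is_union\<close> and
  \<open>span_le\<close> restate the orders and joins for representatives, and composites of classes
  are computed from one choice of representatives and pullback. A join equal to 1 is used in the
  form that the identity factors through every upper bound \<open>u\<close>, that is,
  \<open>u\<close> has a right inverse; for a monic \<open>u\<close> this already makes it
  invertible. The obstacle in the colimit characterization is the converse: a colimit
  \<open>X\<close> of the matching diagram of maps \<open>m i\<close> into \<open>A\<close> comes
  with no map to \<open>A\<close> in \<open>M\<close>. The union \<open>n\<close> of the
  \<open>m i\<close> supplies one. Its domain is a colimit of the same diagram, so \<open>X\<close>
  is isomorphic to it and becomes a subobject of \<open>A\<close> in which the \<open>a i\<close>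
  are the factors of the \<open>m i\<close>. Both \<open>a i \<in> M\<close> and the join being 1
  are then inherited from \<open>n\<close>.\<close>

lemma hom_iff [simp]: "f \<in> hom C A B \<longleftrightarrow> f \<in> Ar C \<and> Dom C f = A \<and> Cod C f = B"
  by (simp add: hom_def)

context category
begin

lemma Dom_Ob [simp]: "f \<in> Ar C \<Longrightarrow> Dom C f \<in> Ob C"
  and Cod_Ob [simp]: "f \<in> Ar C \<Longrightarrow> Cod C f \<in> Ob C"
  using dom_cod by auto

lemma Ident_simps [simp]:
  assumes "A \<in> Ob C"
  shows "Ident C A \<in> Ar C" "Dom C (Ident C A) = A" "Cod C (Ident C A) = A"
  using ident_hom[OF assms] by auto

lemma comp_simps [simp]:
  assumes "f \<in> Ar C" "g \<in> Ar C" "Cod C f = Dom C g"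
  shows "g \<cdot> f \<in> Ar C" "Dom C (g \<cdot> f) = Dom C f" "Cod C (g \<cdot> f) = Cod C g"
  using comp_hom[of f "Dom C f" "Cod C f" g "Cod C g"] assms by auto

lemma comp_Ident [simp]: "f \<in> Ar C \<Longrightarrow> Dom C f = A \<Longrightarrow> f \<cdot> Ident C A = f"
  and Ident_comp [simp]: "f \<in> Ar C \<Longrightarrow> Cod C f = A \<Longrightarrow> Ident C A \<cdot> f = f"
  using comp_ident[of f] ident_comp[of f] by auto

lemma assoc:
  "\<lbrakk>f \<in> Ar C; g \<in> Ar C; h \<in> Ar C; Cod C f = Dom C g; Cod C g = Dom C h\<rbrakk>
    \<Longrightarrow> (h \<cdot> g) \<cdot> f = h \<cdot> (g \<cdot> f)"
  using comp_assoc[of f "Dom C f" "Cod C f" g "Cod C g" h "Cod C h"] by auto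

lemma isoI:
  "\<lbrakk>f \<in> Ar C; g \<in> Ar C; Dom C g = Cod C f; Cod C g = Dom C f;
    g \<cdot> f = Ident C (Dom C f); f \<cdot> g = Ident C (Cod C f)\<rbrakk> \<Longrightarrow> is_iso C f"
  unfolding is_iso_def by auto

lemma isoE:
  assumes "is_iso C f"
  obtains g where "f \<in> Ar C" "g \<in> Ar C" "Dom C g = Cod C f" "Cod C g = Dom C f"
    "g \<cdot> f = Ident C (Dom C f)" "f \<cdot> g = Ident C (Cod C f)" "is_iso C g"
proof -
  obtain g where g: "f \<in> Ar C" "g \<in> Ar C" "Dom C g = Cod C f" "Cod C g = Dom C f"
    "g \<cdot> f = Ident C (Dom C f)" "f \<cdot> g = Ident C (Cod C f)"
    using assms unfolding is_iso_def by auto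
  then have "is_iso C g" by (intro isoI[of g f]) auto
  then show thesis using g that by blast
qed

lemma iso_Ident: "A \<in> Ob C \<Longrightarrow> is_iso C (Ident C A)"
  by (rule isoI[of _ "Ident C A"]) auto

text \<open>In a composite associated to the right, \<open>h \<cdot> g\<close> is no longer a
  subterm; this form lets \<open>simp\<close> cancel it there.\<close>

lemma comp_assoc_cancel:
  assumes "f \<in> Ar C" "g \<in> Ar C" "h \<in> Ar C" "Cod C f = Dom C g" "Cod C g = Dom C h"
    "h \<cdot> g = Ident C (Dom C g)"
  shows "h \<cdot> (g \<cdot> f) = f"
  using assms assoc[of f g h] by auto

lemma monic_cancel:
  "\<lbrakk>is_monic C m; m \<cdot> f = m \<cdot> g; f \<in> Ar C; g \<in> Ar C; Cod C f = Dom C m; Cod C g = Dom C m;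
    Dom C f = Dom C g\<rbrakk> \<Longrightarrow> f = g"
  by (metis Dom_Ob hom_iff is_monic_def)

text \<open>Uniqueness is asked for as joint monicity of the two projections, independently of any
  cone \<open>u\<close>, \<open>v\<close>.\<close>

lemma is_pullbackI:
  assumes "f \<in> Ar C" "g \<in> Ar C" "p \<in> Ar C" "q \<in> Ar C" "Cod C f = Cod C g"
    "Dom C q = Dom C p" "Cod C p = Dom C f" "Cod C q = Dom C g" "f \<cdot> p = g \<cdot> q"
    and ex: "\<And>u v. \<lbrakk>u \<in> Ar C; v \<in> Ar C; Dom C v = Dom C u; Cod C u = Dom C f; Cod C v = Dom C g;
        f \<cdot> u = g \<cdot> v\<rbrakk>
      \<Longrightarrow> \<exists>h \<in> Ar C. Dom C h = Dom C u \<and> Cod C h = Dom C p \<and> p \<cdot> h = u \<and> q \<cdot> h = v"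
    and un: "\<And>h h'. \<lbrakk>h \<in> Ar C; h' \<in> Ar C; Dom C h' = Dom C h; Cod C h = Dom C p;
        Cod C h' = Dom C p; p \<cdot> h = p \<cdot> h'; q \<cdot> h = q \<cdot> h'\<rbrakk> \<Longrightarrow> h = h'"
  shows "is_pullback C f g p q"
  unfolding is_pullback_def
proof (intro conjI ballI impI)
  fix X u v
  assume u: "u \<in> hom C X (Dom C f)" and v: "v \<in> hom C X (Dom C g)" and "f \<cdot> u = g \<cdot> v"
  then obtain h where h: "h \<in> Ar C" "Dom C h = X" "Cod C h = Dom C p" "p \<cdot> h = u" "q \<cdot> h = v"
    using ex[of u v] by auto
  show "\<exists>!h. h \<in> hom C X (Dom C p) \<and> p \<cdot> h = u \<and> q \<cdot> h = v"
  proof (rule ex1I[of _ h])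
    show "h \<in> hom C X (Dom C p) \<and> p \<cdot> h = u \<and> q \<cdot> h = v"
      using h by simp
    show "h' = h"
      if "h' \<in> hom C X (Dom C p) \<and> p \<cdot> h' = u \<and> q \<cdot> h' = v" for h'
      by (rule un) (use that h in auto)
  qed
qed (use assms(1-9) in auto)

lemma is_pullbackD:
  assumes "is_pullback C f g p q"
  shows "f \<in> Ar C" "g \<in> Ar C" "p \<in> Ar C" "q \<in> Ar C" "Cod C f = Cod C g"
    "Dom C q = Dom C p" "Cod C p = Dom C f" "Cod C q = Dom C g" "f \<cdot> p = g \<cdot> q"
  using assms unfolding is_pullback_def by auto

lemma pullback_factor:
  assumes "is_pullback C f g p q" "u \<in> Ar C" "v \<in> Ar C" "Dom C v = Dom C u"
    "Cod C u = Dom C f" "Cod C v = Dom C g" "f \<cdot> u = g \<cdot> v"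
  obtains h where "h \<in> Ar C" "Dom C h = Dom C u" "Cod C h = Dom C p" "p \<cdot> h = u" "q \<cdot> h = v"
proof -
  have "\<forall>X\<in>Ob C. \<forall>u\<in>hom C X (Dom C f). \<forall>v\<in>hom C X (Dom C g). f \<cdot> u = g \<cdot> v \<longrightarrow>
      (\<exists>!h. h \<in> hom C X (Dom C p) \<and> p \<cdot> h = u \<and> q \<cdot> h = v)"
    using assms(1) unfolding is_pullback_def by blast
  then have "\<exists>!h. h \<in> hom C (Dom C u) (Dom C p) \<and> p \<cdot> h = u \<and> q \<cdot> h = v"
    using assms(2-) by auto
  then show thesis using that by auto
qed

lemma pullback_unique:
  assumes "is_pullback C f g p q" "h \<in> Ar C" "h' \<in> Ar C" "Dom C h' = Dom C h"
    "Cod C h = Dom C p" "Cod C h' = Dom C p" "p \<cdot> h = p \<cdot> h'" "q \<cdot> h = q \<cdot> h'"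
  shows "h = h'"
proof -
  note pb = is_pullbackD[OF assms(1)]
  have "\<forall>X\<in>Ob C. \<forall>u\<in>hom C X (Dom C f). \<forall>v\<in>hom C X (Dom C g). f \<cdot> u = g \<cdot> v \<longrightarrow>
      (\<exists>!h. h \<in> hom C X (Dom C p) \<and> p \<cdot> h = u \<and> q \<cdot> h = v)"
    using assms(1) unfolding is_pullback_def by blast
  moreover have "p \<cdot> h \<in> hom C (Dom C h) (Dom C f)" "q \<cdot> h \<in> hom C (Dom C h) (Dom C g)"
    using pb assms(2-) by auto
  moreover have "f \<cdot> (p \<cdot> h) = g \<cdot> (q \<cdot> h)"
    using pb assms(2-) by (simp flip: assoc)
  ultimately have "\<exists>!k. k \<in> hom C (Dom C h) (Dom C p) \<and> p \<cdot> k = p \<cdot> h \<and> q \<cdot> k = q \<cdot> h"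
    using assms(2) Dom_Ob by blast
  then show ?thesis using assms(2-) by auto
qed

lemma pullback_sym:
  assumes "is_pullback C f g p q"
  shows "is_pullback C g f q p"
proof (rule is_pullbackI)
  note pb = is_pullbackD[OF assms]
  show "\<exists>h\<in>Ar C. Dom C h = Dom C u \<and> Cod C h = Dom C q \<and> q \<cdot> h = u \<and> p \<cdot> h = v"
    if "u \<in> Ar C" "v \<in> Ar C" "Dom C v = Dom C u" "Cod C u = Dom C g" "Cod C v = Dom C f"
      "g \<cdot> u = f \<cdot> v" for u v
    using pullback_factor[OF assms, of v u] that pb by metis
  show "h = h'" if "h \<in> Ar C" "h' \<in> Ar C" "Dom C h' = Dom C h" "Cod C h = Dom C q"
      "Cod C h' = Dom C q" "q \<cdot> h = q \<cdot> h'" "p \<cdot> h = p \<cdot> h'" for h h'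
    using pullback_unique[OF assms, of h h'] that pb by simp
qed (use is_pullbackD[OF assms] in auto)

section \<open>Invariance of pullbacks and colimits under isomorphism\<close>

lemma pullback_iso:
  assumes "is_pullback C f g p q" "is_pullback C f g p' q'"
  obtains h where "is_iso C h" "h \<in> Ar C" "Dom C h = Dom C p'" "Cod C h = Dom C p"
    "p' = p \<cdot> h" "q' = q \<cdot> h"
proof -
  note pb = is_pullbackD[OF assms(1)] and pb' = is_pullbackD[OF assms(2)]
  obtain h where h: "h \<in> Ar C" "Dom C h = Dom C p'" "Cod C h = Dom C p" "p \<cdot> h = p'" "q \<cdot> h = q'"
    using pullback_factor[OF assms(1), of p' q'] pb' by auto
  obtain k where k: "k \<in> Ar C" "Dom C k = Dom C p" "Cod C k = Dom C p'" "p' \<cdot> k = p" "q' \<cdot> k = q"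
    using pullback_factor[OF assms(2), of p q] pb by auto
  have "h \<cdot> k = Ident C (Dom C p)"
    by (rule pullback_unique[OF assms(1)])
      (use h k pb pb' in \<open>simp_all flip: assoc\<close>)
  moreover have "k \<cdot> h = Ident C (Dom C p')"
    by (rule pullback_unique[OF assms(2)])
      (use h k pb pb' in \<open>simp_all flip: assoc\<close>)
  ultimately have "is_iso C h" using h k by (intro isoI[of h k]) auto
  then show thesis using h by (intro that[of h]) auto
qed

text \<open>Cones factor through the inverse of \<open>h\<close>. This is the converse of
  \<open>pullback_iso\<close>: the pullbacks of a cospan are exactly the reparametrizations of a
  given one.\<close>

lemma pullback_comp_iso:
  assumes "is_pullback C f g p q" "is_iso C h" "Cod C h = Dom C p"
  shows "is_pullback C f g (p \<cdot> h) (q \<cdot> h)"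
proof -
  note pb = is_pullbackD[OF assms(1)]
  obtain k where k: "h \<in> Ar C" "k \<in> Ar C" "Dom C k = Cod C h" "Cod C k = Dom C h"
    "k \<cdot> h = Ident C (Dom C h)" "h \<cdot> k = Ident C (Cod C h)"
    using assms(2) by (rule isoE)
  show ?thesis
  proof (rule is_pullbackI)
    fix u v assume uv: "u \<in> Ar C" "v \<in> Ar C" "Dom C v = Dom C u" "Cod C u = Dom C f"
      "Cod C v = Dom C g" "f \<cdot> u = g \<cdot> v"
    obtain t where t: "t \<in> Ar C" "Dom C t = Dom C u" "Cod C t = Dom C p" "p \<cdot> t = u" "q \<cdot> t = v"
      by (rule pullback_factor[OF assms(1) uv])
    show "\<exists>t\<in>Ar C. Dom C t = Dom C u \<and> Cod C t = Dom C (p \<cdot> h) \<and> (p \<cdot> h) \<cdot> t = u \<and> (q \<cdot> h) \<cdot> t = v"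
      by (rule bexI[of _ "k \<cdot> t"]) (use t k pb assms(3) in \<open>auto simp: assoc comp_assoc_cancel\<close>)
  next
    fix t t' assume t: "t \<in> Ar C" "t' \<in> Ar C" "Dom C t' = Dom C t" "Cod C t = Dom C (p \<cdot> h)"
      "Cod C t' = Dom C (p \<cdot> h)" "(p \<cdot> h) \<cdot> t = (p \<cdot> h) \<cdot> t'" "(q \<cdot> h) \<cdot> t = (q \<cdot> h) \<cdot> t'"
    have "h \<cdot> t = h \<cdot> t'"
      by (rule pullback_unique[OF assms(1)]) (use t k pb assms(3) in \<open>auto simp: assoc\<close>)
    then have "k \<cdot> (h \<cdot> t) = k \<cdot> (h \<cdot> t')" by simp
    then show "t = t'" using t k pb assms(3) by (simp add: comp_assoc_cancel)
  qed (use k pb assms(3) in \<open>auto simp flip: assoc\<close>)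
qed

text \<open>Moving the isomorphisms from the cospan to the projections turns a pullback of other
  representatives into one of \<open>f\<close> and \<open>g\<close>. \<open>Comp\<close> of
  \<open>Par\<close> ranges over all representatives, so computing composites depends on
  this.\<close>

lemma pullback_of_comp_iso:
  assumes "is_pullback C (f \<cdot> s) (g \<cdot> t) p q" "is_iso C s" "is_iso C t"
    "f \<in> Ar C" "g \<in> Ar C" "Cod C s = Dom C f" "Cod C t = Dom C g"
  shows "is_pullback C f g (s \<cdot> p) (t \<cdot> q)"
proof -
  obtain s' where s: "s \<in> Ar C" "s' \<in> Ar C" "Dom C s' = Cod C s" "Cod C s' = Dom C s"
    "s' \<cdot> s = Ident C (Dom C s)" "s \<cdot> s' = Ident C (Cod C s)"
    using assms(2) by (rule isoE)
  obtain t' where t: "t \<in> Ar C" "t' \<in> Ar C" "Dom C t' = Cod C t" "Cod C t' = Dom C t"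
    "t' \<cdot> t = Ident C (Dom C t)" "t \<cdot> t' = Ident C (Cod C t)"
    using assms(3) by (rule isoE)
  note pb = is_pullbackD[OF assms(1)]
  show ?thesis
  proof (rule is_pullbackI)
    fix u v assume uv: "u \<in> Ar C" "v \<in> Ar C" "Dom C v = Dom C u" "Cod C u = Dom C f"
      "Cod C v = Dom C g" "f \<cdot> u = g \<cdot> v"
    obtain k where k: "k \<in> Ar C" "Dom C k = Dom C (s' \<cdot> u)" "Cod C k = Dom C p"
      "p \<cdot> k = s' \<cdot> u" "q \<cdot> k = t' \<cdot> v"
      by (rule pullback_factor[OF assms(1), of "s' \<cdot> u" "t' \<cdot> v"])
        (use s t uv assms in \<open>auto simp: assoc comp_assoc_cancel\<close>)
    show "\<exists>k\<in>Ar C. Dom C k = Dom C u \<and> Cod C k = Dom C (s \<cdot> p) \<and> (s \<cdot> p) \<cdot> k = u \<and> (t \<cdot> q) \<cdot> k = v"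
      by (rule bexI[of _ k]) (use k s t uv pb assms in \<open>auto simp: assoc comp_assoc_cancel\<close>)
  next
    fix k k' assume k: "k \<in> Ar C" "k' \<in> Ar C" "Dom C k' = Dom C k" "Cod C k = Dom C (s \<cdot> p)"
      "Cod C k' = Dom C (s \<cdot> p)" "(s \<cdot> p) \<cdot> k = (s \<cdot> p) \<cdot> k'" "(t \<cdot> q) \<cdot> k = (t \<cdot> q) \<cdot> k'"
    have "s' \<cdot> (s \<cdot> (p \<cdot> k)) = s' \<cdot> (s \<cdot> (p \<cdot> k'))" "t' \<cdot> (t \<cdot> (q \<cdot> k)) = t' \<cdot> (t \<cdot> (q \<cdot> k'))"
      using k s t pb assms by (simp_all flip: assoc[of k] assoc[of k'])
    then have eq: "p \<cdot> k = p \<cdot> k'" "q \<cdot> k = q \<cdot> k'"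
      using k s t pb assms by (simp_all add: comp_assoc_cancel)
    show "k = k'"
      by (rule pullback_unique[OF assms(1)]) (use k(1-5) s t pb assms(4-7) eq in auto)
  qed (use s(1) t(1) pb assms(4-7) in \<open>auto simp: assoc\<close>)
qed

text \<open>Serves to identify an arbitrary colimit of a matching diagram with the domain of a
  union.\<close>

lemma colimit_iso:
  assumes "is_colimit C D X l" "is_colimit C D Y l'"
  obtains h where "is_iso C h" "Dom C h = X" "Cod C h = Y" "\<And>v. v \<in> Verts D \<Longrightarrow> h \<cdot> l v = l' v"
proof -
  have cc: "is_cocone C D X l" "is_cocone C D Y l'"
    and ex: "\<And>Z k. is_cocone C D Z k \<Longrightarrow> \<exists>!h. h \<in> hom C X Z \<and> (\<forall>v \<in> Verts D. h \<cdot> l v = k v)"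
      "\<And>Z k. is_cocone C D Z k \<Longrightarrow> \<exists>!h. h \<in> hom C Y Z \<and> (\<forall>v \<in> Verts D. h \<cdot> l' v = k v)"
    using assms unfolding is_colimit_def by blast+
  have l: "l v \<in> Ar C" "Cod C (l v) = X" "l' v \<in> Ar C" "Cod C (l' v) = Y" if "v \<in> Verts D" for v
    using cc that unfolding is_cocone_def by auto
  have XY: "X \<in> Ob C" "Y \<in> Ob C" using cc unfolding is_cocone_def by auto
  obtain h where h: "h \<in> hom C X Y" "\<forall>v \<in> Verts D. h \<cdot> l v = l' v" using ex(1)[OF cc(2)] by blast
  obtain k where k: "k \<in> hom C Y X" "\<forall>v \<in> Verts D. k \<cdot> l' v = l v" using ex(2)[OF cc(1)] by blast
  have "k \<cdot> h \<in> hom C X X \<and> (\<forall>v \<in> Verts D. (k \<cdot> h) \<cdot> l v = l v)"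
    "Ident C X \<in> hom C X X \<and> (\<forall>v \<in> Verts D. Ident C X \<cdot> l v = l v)"
    using h k l XY by (auto simp: assoc)
  then have "k \<cdot> h = Ident C X" using ex(1)[OF cc(1)] by blast
  moreover have "h \<cdot> k \<in> hom C Y Y \<and> (\<forall>v \<in> Verts D. (h \<cdot> k) \<cdot> l' v = l' v)"
    "Ident C Y \<in> hom C Y Y \<and> (\<forall>v \<in> Verts D. Ident C Y \<cdot> l' v = l' v)"
    using h k l XY by (auto simp: assoc)
  then have "h \<cdot> k = Ident C Y" using ex(2)[OF cc(2)] by blast
  ultimately have "is_iso C h" using h k by (intro isoI[of h k]) auto
  then show thesis using h by (intro that[of h]) auto
qed

text \<open>The preorder on arrows that underlies the order of \<open>Sub\<close>, so that joins of
  subobjects can be handled without isomorphism classes.\<close>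

definition factors :: "'a \<Rightarrow> 'a \<Rightarrow> bool" where
  "factors m n \<longleftrightarrow> (\<exists>k \<in> Ar C. Dom C k = Dom C m \<and> Cod C k = Dom C n \<and> n \<cdot> k = m)"

lemma factorsI: "k \<in> Ar C \<Longrightarrow> n \<in> Ar C \<Longrightarrow> Cod C k = Dom C n \<Longrightarrow> n \<cdot> k = m \<Longrightarrow> factors m n"
  unfolding factors_def by auto

lemma factorsE:
  assumes "factors m n"
  obtains k where "k \<in> Ar C" "Dom C k = Dom C m" "Cod C k = Dom C n" "n \<cdot> k = m"
  using assms unfolding factors_def by blast

lemma factors_refl: "m \<in> Ar C \<Longrightarrow> factors m m"
  by (rule factorsI[of "Ident C (Dom C m)"]) auto

lemma factors_trans:
  assumes "factors l m" "factors m n" "n \<in> Ar C"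
  shows "factors l n"
proof -
  obtain j where j: "j \<in> Ar C" "Dom C j = Dom C l" "Cod C j = Dom C m" "m \<cdot> j = l"
    using assms(1) by (rule factorsE)
  obtain k where k: "k \<in> Ar C" "Dom C k = Dom C m" "Cod C k = Dom C n" "n \<cdot> k = m"
    using assms(2) by (rule factorsE)
  show ?thesis
    by (rule factorsI[of "k \<cdot> j"]) (use j k assms(3) in \<open>simp_all flip: assoc\<close>)
qed

lemma factors_Ident: "m \<in> Ar C \<Longrightarrow> Cod C m = X \<Longrightarrow> factors m (Ident C X)"
  by (rule factorsI[of m]) auto

lemma factors_iso:
  assumes "is_iso C h" "m \<in> Ar C" "Cod C h = Dom C m"
  shows "factors (m \<cdot> h) m" "factors m (m \<cdot> h)"
proof -
  obtain k where k: "h \<in> Ar C" "k \<in> Ar C" "Dom C k = Cod C h" "Cod C k = Dom C h"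
    "k \<cdot> h = Ident C (Dom C h)" "h \<cdot> k = Ident C (Cod C h)"
    using assms(1) by (rule isoE)
  show "factors (m \<cdot> h) m"
    by (rule factorsI[of h]) (use k assms in auto)
  show "factors m (m \<cdot> h)"
    by (rule factorsI[of k]) (use k assms in \<open>auto simp: assoc\<close>)
qed

end

section \<open>Subobjects\<close>

context M_category
begin

lemma M_Ar [simp]: "m \<in> M \<Longrightarrow> m \<in> Ar C"
  using M_monic unfolding is_monic_def by blast

lemma M_cancel:
  "\<lbrakk>m \<in> M; m \<cdot> f = m \<cdot> g; f \<in> Ar C; g \<in> Ar C; Cod C f = Dom C m; Cod C g = Dom C m;
    Dom C f = Dom C g\<rbrakk> \<Longrightarrow> f = g"
  using monic_cancel M_monic by blast

text \<open>The axiom provides one pullback whose projection is in \<open>M\<close>; every other one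
  differs from it by an isomorphism, which lies in \<open>M\<close> too.\<close>

lemma pullback_M:
  assumes "is_pullback C m f p q" "m \<in> M"
  shows "q \<in> M"
proof -
  note pb = is_pullbackD[OF assms(1)]
  obtain p' q' where pb': "is_pullback C m f p' q'" "q' \<in> M"
    using M_pullback[of m f] assms pb by auto
  obtain h where "is_iso C h" "h \<in> Ar C" "Cod C h = Dom C p'" "q = q' \<cdot> h"
    using pullback_iso[OF pb'(1) assms(1)] by metis
  then show ?thesis using M_iso M_comp pb' is_pullbackD[OF pb'(1)] by auto
qed

text \<open>As \<open>n\<close> is monic, \<open>n \<cdot> u = (n \<cdot> k) \<cdot> v\<close>
  forces \<open>u = k \<cdot> v\<close>, so a cone is the same as its leg \<open>v\<close>.\<close>

lemma pullback_of_comp: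
  assumes "n \<in> M" "k \<in> Ar C" "Cod C k = Dom C n"
  shows "is_pullback C n (n \<cdot> k) k (Ident C (Dom C k))"
proof (rule is_pullbackI)
  show "\<exists>h\<in>Ar C. Dom C h = Dom C u \<and> Cod C h = Dom C k \<and> k \<cdot> h = u \<and> Ident C (Dom C k) \<cdot> h = v"
    if uv: "u \<in> Ar C" "v \<in> Ar C" "Dom C v = Dom C u" "Cod C u = Dom C n"
      "Cod C v = Dom C (n \<cdot> k)" "n \<cdot> u = (n \<cdot> k) \<cdot> v" for u v
  proof (rule bexI[of _ v])
    have "k \<cdot> v = u"
      by (rule M_cancel[OF assms(1)]) (use uv assms in \<open>auto simp: assoc\<close>)
    then show "Dom C v = Dom C u \<and> Cod C v = Dom C k \<and> k \<cdot> v = u \<and> Ident C (Dom C k) \<cdot> v = v"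
      using uv assms by auto
  qed (use uv in auto)
qed (use assms in auto)

text \<open>\<open>k\<close> is the pullback of \<open>n \<cdot> k\<close> along \<open>n\<close>,
  so stability of \<open>M\<close> under pullback applies.\<close>

lemma M_cancel_left:
  assumes "n \<in> M" "n \<cdot> k \<in> M" "k \<in> Ar C" "Cod C k = Dom C n"
  shows "k \<in> M"
  using pullback_M[OF pullback_sym[OF pullback_of_comp]] assms by blast

text \<open>A join in \<open>Sub\<close> stated for a representative \<open>n\<close>, hence fixing
  \<open>n\<close> only up to isomorphism over its codomain. For empty \<open>I\<close> it describes
  a least subobject.\<close>

definition is_union :: "'i set \<Rightarrow> ('i \<Rightarrow> 'a) \<Rightarrow> 'a \<Rightarrow> bool" where
  "is_union I m n \<longleftrightarrow> n \<in> M \<and> (\<forall>i \<in> I. factors (m i) n) \<and>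
    (\<forall>u \<in> M. Cod C u = Cod C n \<and> (\<forall>i \<in> I. factors (m i) u) \<longrightarrow> factors n u)"

lemma subobject_self: "m \<in> M \<Longrightarrow> m \<in> subobject C M m"
  unfolding subobject_def
  by (auto intro!: bexI[of _ "Ident C (Dom C m)"] iso_Ident)

text \<open>\<open>Sub\<close> compares classes through some pair of representatives; by
  \<open>factors_iso\<close> these can be exchanged for \<open>m\<close> and
  \<open>n\<close>.\<close>

lemma le_Sub_iff:
  assumes "m \<in> M" "n \<in> M"
  shows "subobject C M m \<sqsubseteq>\<^bsub>Sub C M X\<^esub> subobject C M n \<longleftrightarrow> factors m n"
proof
  assume "subobject C M m \<sqsubseteq>\<^bsub>Sub C M X\<^esub> subobject C M n"
  then obtain m' n' k where mn: "m' \<in> subobject C M m" "n' \<in> subobject C M n"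
    "k \<in> hom C (Dom C m') (Dom C n')" "n' \<cdot> k = m'"
    unfolding Sub_def by auto
  have M: "m' \<in> M" "n' \<in> M" using mn(1,2) unfolding subobject_def by auto
  have "factors m m'" "factors n' n"
    using mn(1,2) assms unfolding subobject_def by (auto intro: factors_iso)
  moreover have "factors m' n'"
    by (rule factorsI[of k]) (use mn M in auto)
  ultimately show "factors m n" using factors_trans M assms by (meson M_Ar)
next
  assume "factors m n"
  then obtain k where k: "k \<in> Ar C" "Dom C k = Dom C m" "Cod C k = Dom C n" "n \<cdot> k = m"
    by (rule factorsE)
  show "subobject C M m \<sqsubseteq>\<^bsub>Sub C M X\<^esub> subobject C M n"
    unfolding Sub_def
    by (simp, intro bexI[of _ m] bexI[of _ n] bexI[of _ k]) (use k assms subobject_self in auto)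
qed

lemma is_join_Sub_iff:
  assumes "\<And>i. i \<in> I \<Longrightarrow> m i \<in> M \<and> Cod C (m i) = X" "n \<in> M" "Cod C n = X"
  shows "is_join (Sub C M X) ((\<lambda>i. subobject C M (m i)) ` I) (subobject C M n) \<longleftrightarrow> is_union I m n"
proof -
  have carrier: "carrier (Sub C M X) = subobject C M ` {m \<in> M. Cod C m = X}"
    by (simp add: Sub_def)
  have upper: "Upper (Sub C M X) ((\<lambda>i. subobject C M (m i)) ` I) =
      subobject C M ` {u \<in> M. Cod C u = X \<and> (\<forall>i \<in> I. factors (m i) u)}"
  proof (intro equalityI subsetI)
    fix x assume "x \<in> Upper (Sub C M X) ((\<lambda>i. subobject C M (m i)) ` I)"
    then obtain u where u: "x = subobject C M u" "u \<in> M" "Cod C u = X"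
      and le: "\<And>y. y \<in> (\<lambda>i. subobject C M (m i)) ` I \<inter> carrier (Sub C M X) \<Longrightarrow> y \<sqsubseteq>\<^bsub>Sub C M X\<^esub> x"
      unfolding Upper_def carrier by blast
    have "factors (m i) u" if "i \<in> I" for i
      using le[of "subobject C M (m i)"] that assms(1)[OF that] u by (simp add: carrier le_Sub_iff)
    then show "x \<in> subobject C M ` {u \<in> M. Cod C u = X \<and> (\<forall>i \<in> I. factors (m i) u)}"
      using u by blast
  qed (use assms(1) in \<open>auto simp: Upper_def carrier le_Sub_iff\<close>)
  show ?thesis
  proof
    assume "is_join (Sub C M X) ((\<lambda>i. subobject C M (m i)) ` I) (subobject C M n)"
    then have *: "subobject C M n \<in> subobject C M ` {u \<in> M. Cod C u = X \<and> (\<forall>i \<in> I. factors (m i) u)}"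
      "\<And>u. u \<in> M \<Longrightarrow> Cod C u = X \<Longrightarrow> \<forall>i \<in> I. factors (m i) u \<Longrightarrow> factors n u"
      using assms(2) by (auto simp: is_join_def least_def upper le_Sub_iff)
    \<comment> \<open>Membership of the class of \<open>n\<close> among the upper bounds only yields
      some \<open>u\<close> in that class that bounds the family; equality of the classes carries
      the bound over to \<open>n\<close>.\<close>
    then obtain u where u: "subobject C M n = subobject C M u" "u \<in> M" "\<forall>i \<in> I. factors (m i) u"
      by auto
    then have "factors u n"
      using le_Sub_iff[of u n X] le_Sub_iff[of u u X] assms(2) factors_refl by simp
    then show "is_union I m n"
      unfolding is_union_def using * u assms(2,3) factors_trans[of _ u n] by auto
  next
    assume "is_union I m n"
    then show "is_join (Sub C M X) ((\<lambda>i. subobject C M (m i)) ` I) (subobject C M n)"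
      using assms(2,3) by (auto simp: is_join_def least_def upper carrier le_Sub_iff is_union_def)
  qed
qed

section \<open>Partial maps\<close>

lemma spans_iff: "(m, f) \<in> spans C M \<longleftrightarrow> m \<in> M \<and> f \<in> Ar C \<and> Dom C f = Dom C m"
  by (simp add: spans_def)

lemma span_class_iff:
  "(m', f') \<in> span_class C M (m, f) \<longleftrightarrow> (m', f') \<in> spans C M \<and>
    (\<exists>h. is_iso C h \<and> h \<in> Ar C \<and> Dom C h = Dom C m' \<and> Cod C h = Dom C m \<and> m \<cdot> h = m' \<and> f \<cdot> h = f')"
  unfolding span_class_def Bex_def by (simp only: mem_Collect_eq case_prod_conv hom_iff) blast

lemma span_class_self: "\<lbrakk>m \<in> M; f \<in> Ar C; Dom C f = Dom C m\<rbrakk> \<Longrightarrow> (m, f) \<in> span_class C M (m, f)"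
  unfolding span_class_iff spans_iff
  by (simp, rule exI[of _ "Ident C (Dom C m)"]) (simp add: iso_Ident)

lemma span_classE:
  assumes "(m', f') \<in> span_class C M (m, f)"
  obtains h where "is_iso C h" "h \<in> Ar C" "Dom C h = Dom C m'" "Cod C h = Dom C m"
    "m \<cdot> h = m'" "f \<cdot> h = f'"
  using assms unfolding span_class_iff by blast

lemma span_classI:
  assumes "is_iso C h" "h \<in> Ar C" "Cod C h = Dom C m" "m \<in> M" "f \<in> Ar C" "Dom C f = Dom C m"
  shows "(m \<cdot> h, f \<cdot> h) \<in> span_class C M (m, f)"
  unfolding span_class_iff spans_iff using assms M_comp[of h m] M_iso[of h]
  by (intro conjI exI[of _ h]) auto

text \<open>\<open>the_elem\<close> gives the expected value only if the codomain is constant on the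
  class, and an isomorphic span \<open>(m \<cdot> h, f \<cdot> h)\<close> does have the same
  one.\<close>

lemma Dom_Par [simp]:
  assumes "m \<in> M" "f \<in> Ar C" "Dom C f = Dom C m"
  shows "Dom (Par C M) (span_class C M (m, f)) = Cod C m"
proof -
  have eq: "Cod C m' = Cod C m" if "(m', f') \<in> span_class C M (m, f)" for m' f'
    using that by (rule span_classE) (use assms in auto)
  have "the_elem ((\<lambda>(m, f). Cod C m) ` span_class C M (m, f)) = (\<lambda>(m, f). Cod C m) (m, f)"
  proof (rule the_elem_image_unique)
    show "(\<lambda>(m, f). Cod C m) y = (\<lambda>(m, f). Cod C m) (m, f)" if "y \<in> span_class C M (m, f)" for y
      using eq[of "fst y" "snd y"] that by (simp add: split_beta)
  qed (use span_class_self[OF assms] in blast)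
  then show ?thesis by (simp add: Par_def)
qed

lemma Cod_Par [simp]:
  assumes "m \<in> M" "f \<in> Ar C" "Dom C f = Dom C m"
  shows "Cod (Par C M) (span_class C M (m, f)) = Cod C f"
proof -
  have eq: "Cod C f' = Cod C f" if "(m', f') \<in> span_class C M (m, f)" for m' f'
    using that by (rule span_classE) (use assms in auto)
  have "the_elem ((\<lambda>(m, f). Cod C f) ` span_class C M (m, f)) = (\<lambda>(m, f). Cod C f) (m, f)"
  proof (rule the_elem_image_unique)
    show "(\<lambda>(m, f). Cod C f) y = (\<lambda>(m, f). Cod C f) (m, f)" if "y \<in> span_class C M (m, f)" for y
      using eq[of "fst y" "snd y"] that by (simp add: split_beta)
  qed (use span_class_self[OF assms] in blast)
  then show ?thesis by (simp add: Par_def)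
qed

lemma Ob_Par [simp]: "Ob (Par C M) = Ob C"
  and Ar_Par: "Ar (Par C M) = span_class C M ` spans C M"
  by (simp_all add: Par_def)

lemma span_class_hom_Par:
  "\<lbrakk>m \<in> M; f \<in> Ar C; Dom C f = Dom C m\<rbrakk>
    \<Longrightarrow> span_class C M (m, f) \<in> hom (Par C M) (Cod C m) (Cod C f)"
  by (simp add: Ar_Par spans_iff)

lemma hom_ParE:
  assumes "\<phi> \<in> hom (Par C M) A B"
  obtains m f where "m \<in> M" "f \<in> Ar C" "Dom C f = Dom C m" "Cod C m = A" "Cod C f = B"
    "\<phi> = span_class C M (m, f)"
proof -
  have "\<phi> \<in> span_class C M ` spans C M" using assms by (simp add: Ar_Par)
  then obtain m f where *: "m \<in> M" "f \<in> Ar C" "Dom C f = Dom C m" "\<phi> = span_class C M (m, f)"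
    by (auto simp: spans_iff)
  then show thesis using assms by (intro that) auto
qed

lemma Par_rst_span_class:
  assumes "m \<in> M" "f \<in> Ar C" "Dom C f = Dom C m"
  shows "Par_rst (span_class C M (m, f)) = span_class C M (m, m)"
proof (intro equalityI subsetI)
  fix x assume "x \<in> Par_rst (span_class C M (m, f))"
  then obtain m' f' where "x = (m', m')" "(m', f') \<in> span_class C M (m, f)"
    by (auto simp: Par_rst_def)
  then show "x \<in> span_class C M (m, m)"
    using assms by (auto elim!: span_classE intro: span_classI)
next
  fix x assume "x \<in> span_class C M (m, m)"
  then obtain h where h: "is_iso C h" "h \<in> Ar C" "Cod C h = Dom C m" "x = (m \<cdot> h, m \<cdot> h)"
    using assms by (cases x) (auto elim!: span_classE)
  then have "(m \<cdot> h, f \<cdot> h) \<in> span_class C M (m, f)" using assms by (intro span_classI) auto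
  then show "x \<in> Par_rst (span_class C M (m, f))"
    unfolding Par_rst_def h(4) by (force simp: image_iff)
qed

text \<open>The composite of classes collects composites over all representatives and all pullbacks.
  The isomorphisms between representatives are absorbed into the projections, leaving another
  pullback of \<open>n\<close> and \<open>f\<close>, which differs from \<open>p\<close>,
  \<open>q\<close> by one isomorphism of spans. Conversely, reparametrizing the pullback reaches the
  whole class.\<close>

lemma comp_Par:
  assumes mf: "m \<in> M" "f \<in> Ar C" "Dom C f = Dom C m" and ng: "n \<in> M" "g \<in> Ar C" "Dom C g = Dom C n"
    and pb: "is_pullback C n f p q"
  shows "span_class C M (n, g) \<cdot>\<^bsub>Par C M\<^esub> span_class C M (m, f) = span_class C M (m \<cdot> q, g \<cdot> p)"
    (is "?lhs = ?rhs")
proof -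
  note pq = is_pullbackD[OF pb]
  have qM: "q \<in> M" "m \<cdot> q \<in> M" using pullback_M[OF pb ng(1)] M_comp[of q m] mf pq by auto
  have lhs: "?lhs = {(m' \<cdot> q', g' \<cdot> p') | m' f' n' g' p' q'. (m', f') \<in> span_class C M (m, f) \<and>
      (n', g') \<in> span_class C M (n, g) \<and> is_pullback C n' f' p' q'}"
    by (simp add: Par_def)
  show ?thesis
  proof (intro equalityI subsetI)
    fix x assume "x \<in> ?lhs"
    then obtain m' f' n' g' p' q' where x: "x = (m' \<cdot> q', g' \<cdot> p')"
      "(m', f') \<in> span_class C M (m, f)" "(n', g') \<in> span_class C M (n, g)"
      "is_pullback C n' f' p' q'" unfolding lhs by blast
    obtain s where s: "is_iso C s" "s \<in> Ar C" "Dom C s = Dom C m'" "Cod C s = Dom C m"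
      "m \<cdot> s = m'" "f \<cdot> s = f'" using x(2) by (rule span_classE)
    obtain t where t: "is_iso C t" "t \<in> Ar C" "Dom C t = Dom C n'" "Cod C t = Dom C n"
      "n \<cdot> t = n'" "g \<cdot> t = g'" using x(3) by (rule span_classE)
    have pb': "is_pullback C (n \<cdot> t) (f \<cdot> s) p' q'" using x(4) s(6) t(5) by simp
    note pq' = is_pullbackD[OF pb']
    have "is_pullback C n f (t \<cdot> p') (s \<cdot> q')"
      by (rule pullback_of_comp_iso[OF pb']) (use s(1,2,4) t(1,2,4) mf ng in auto)
    then obtain h where h: "is_iso C h" "h \<in> Ar C" "Cod C h = Dom C p" "t \<cdot> p' = p \<cdot> h"
      "s \<cdot> q' = q \<cdot> h"
      using pullback_iso[OF pb] by metis
    have "m' \<cdot> q' = m \<cdot> (s \<cdot> q')" "g' \<cdot> p' = g \<cdot> (t \<cdot> p')"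
      unfolding s(5)[symmetric] t(6)[symmetric] using s(2,4) t(2,4) pq' mf ng by (auto simp: assoc)
    then have "x = ((m \<cdot> q) \<cdot> h, (g \<cdot> p) \<cdot> h)"
      unfolding x(1) h(4,5) using h(1-3) pq mf ng by (auto simp: assoc)
    then show "x \<in> ?rhs" using h(1-3) pq mf ng qM by (auto intro!: span_classI)
  next
    fix x assume "x \<in> ?rhs"
    then obtain h where h: "is_iso C h" "h \<in> Ar C" "Cod C h = Dom C (m \<cdot> q)"
      "x = ((m \<cdot> q) \<cdot> h, (g \<cdot> p) \<cdot> h)"
      by (cases x) (auto elim!: span_classE)
    have "is_pullback C n f (p \<cdot> h) (q \<cdot> h)"
      by (rule pullback_comp_iso[OF pb]) (use h pq mf in auto)
    moreover have "x = (m \<cdot> (q \<cdot> h), g \<cdot> (p \<cdot> h))"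
      using h pq mf ng by (auto simp: assoc)
    ultimately show "x \<in> ?lhs"
      unfolding lhs using span_class_self[OF mf] span_class_self[OF ng] by blast
  qed
qed

section \<open>The order on partial maps and its joins\<close>

definition span_le :: "'a \<times> 'a \<Rightarrow> 'a \<times> 'a \<Rightarrow> bool" where
  "span_le = (\<lambda>(m, f) (n, g).
    \<exists>k \<in> Ar C. Dom C k = Dom C m \<and> Cod C k = Dom C n \<and> n \<cdot> k = m \<and> g \<cdot> k = f)"

text \<open>The restriction of \<open>(m, f)\<close> is \<open>(m, m)\<close>, so the order asserts
  that \<open>(m, f)\<close> is the composite of \<open>(n, g)\<close> with \<open>(m, m)\<close>,
  which is computed by pulling \<open>n\<close> back along \<open>m\<close>.\<close>

lemma le_hom_order_Par_iff:
  assumes mf: "m \<in> M" "f \<in> Ar C" "Dom C f = Dom C m" and ng: "n \<in> M" "g \<in> Ar C" "Dom C g = Dom C n"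
    and "Cod C m = Cod C n"
  shows "span_class C M (m, f) \<sqsubseteq>\<^bsub>hom_order (Par C M) Par_rst A B\<^esub> span_class C M (n, g)
    \<longleftrightarrow> span_le (m, f) (n, g)"
proof -
  have "span_class C M (m, f) \<sqsubseteq>\<^bsub>hom_order (Par C M) Par_rst A B\<^esub> span_class C M (n, g) \<longleftrightarrow>
      span_class C M (m, f) = span_class C M (n, g) \<cdot>\<^bsub>Par C M\<^esub> span_class C M (m, m)"
    by (simp add: hom_order_def Par_rst_span_class[OF mf])
  also have "\<dots> \<longleftrightarrow> span_le (m, f) (n, g)"
  proof
    obtain p q where pb: "is_pullback C n m p q" using M_pullback[of n m] assms by auto
    note pq = is_pullbackD[OF pb]
    have qM: "q \<in> M" "m \<cdot> q \<in> M" using pullback_M[OF pb ng(1)] M_comp[of q m] mf pq by auto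
    assume "span_class C M (m, f) = span_class C M (n, g) \<cdot>\<^bsub>Par C M\<^esub> span_class C M (m, m)"
    then have "(m, f) \<in> span_class C M (m \<cdot> q, g \<cdot> p)"
      using comp_Par[OF _ _ _ ng pb] mf span_class_self[OF mf] by simp
    then obtain h where h: "h \<in> Ar C" "Dom C h = Dom C m" "Cod C h = Dom C (m \<cdot> q)"
      "(m \<cdot> q) \<cdot> h = m" "(g \<cdot> p) \<cdot> h = f"
      by (rule span_classE)
    \<comment> \<open>The isomorphism \<open>h\<close> of spans together with the projection
      \<open>p\<close> gives the required factor \<open>p \<cdot> h\<close> of \<open>m\<close>
      through \<open>n\<close>.\<close>
    have "n \<cdot> (p \<cdot> h) = (n \<cdot> p) \<cdot> h" using h(1-3) pq mf ng by (subst assoc) auto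
    also have "\<dots> = (m \<cdot> q) \<cdot> h" using pq by simp
    finally have "n \<cdot> (p \<cdot> h) = m" using h(4) by simp
    moreover have "g \<cdot> (p \<cdot> h) = f" using h(1-3) pq mf ng by (subst h(5)[symmetric]) (auto simp: assoc)
    ultimately show "span_le (m, f) (n, g)"
      unfolding span_le_def using h(1-3) pq mf by (auto intro!: bexI[of _ "p \<cdot> h"])
  next
    assume "span_le (m, f) (n, g)"
    then obtain k where k: "k \<in> Ar C" "Dom C k = Dom C m" "Cod C k = Dom C n" "n \<cdot> k = m" "g \<cdot> k = f"
      unfolding span_le_def by auto
    \<comment> \<open>Since \<open>m = n \<cdot> k\<close> with \<open>n\<close> monic, this
      pullback is trivial, and the composite becomes
      \<open>(m, g \<cdot> k) = (m, f)\<close>.\<close>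
    have "is_pullback C n m k (Ident C (Dom C m))"
      using pullback_of_comp[OF ng(1) k(1,3)] k by simp
    then show "span_class C M (m, f) = span_class C M (n, g) \<cdot>\<^bsub>Par C M\<^esub> span_class C M (m, m)"
      using comp_Par[OF _ _ _ ng] mf k by simp
  qed
  finally show ?thesis .
qed

text \<open>The join axioms provide joins of classes; the two conclusions are the upper bound
  property and the leastness read off on representatives.\<close>

lemma is_join_ParD:
  assumes mf: "\<And>i. i \<in> I \<Longrightarrow> m i \<in> M \<and> f i \<in> Ar C \<and> Dom C (f i) = Dom C (m i) \<and> Cod C (m i) = A \<and> Cod C (f i) = B"
    and kh: "k \<in> M" "h \<in> Ar C" "Dom C h = Dom C k" "Cod C k = A" "Cod C h = B"
    and join: "is_join (hom_order (Par C M) Par_rst A B)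
      ((\<lambda>i. span_class C M (m i, f i)) ` I) (span_class C M (k, h))"
  shows "i \<in> I \<Longrightarrow> span_le (m i, f i) (k, h)"
    and "\<lbrakk>n \<in> M; g \<in> Ar C; Dom C g = Dom C n; Cod C n = A; Cod C g = B;
      \<And>i. i \<in> I \<Longrightarrow> span_le (m i, f i) (n, g)\<rbrakk> \<Longrightarrow> span_le (k, h) (n, g)"
proof -
  let ?L = "hom_order (Par C M) Par_rst A B"
  have carrier: "span_class C M (n, g) \<in> carrier ?L"
    if "n \<in> M" "g \<in> Ar C" "Dom C g = Dom C n" "Cod C n = A" "Cod C g = B" for n g
    using span_class_hom_Par[of n g] that unfolding hom_order_def by simp
  \<comment> \<open>\<open>Upper\<close> tests a bound only against those members of the set that
    lie in the carrier, so this inclusion is what makes it a bound of every span.\<close>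
  have sub: "(\<lambda>i. span_class C M (m i, f i)) ` I \<subseteq> carrier ?L"
    using mf carrier by blast
  have up: "span_class C M (k, h) \<in> Upper ?L ((\<lambda>i. span_class C M (m i, f i)) ` I)"
    and least: "\<And>x. x \<in> Upper ?L ((\<lambda>i. span_class C M (m i, f i)) ` I) \<Longrightarrow> span_class C M (k, h) \<sqsubseteq>\<^bsub>?L\<^esub> x"
    using join unfolding is_join_def least_def by auto
  show "span_le (m i, f i) (k, h)" if "i \<in> I"
  proof -
    have "span_class C M (m i, f i) \<sqsubseteq>\<^bsub>?L\<^esub> span_class C M (k, h)"
      using up sub that unfolding Upper_def by blast
    then show ?thesis using mf[OF that] kh(4) le_hom_order_Par_iff[OF _ _ _ kh(1-3)] by simp
  qed
  assume n: "n \<in> M" "g \<in> Ar C" "Dom C g = Dom C n" "Cod C n = A" "Cod C g = B"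
    and le: "\<And>i. i \<in> I \<Longrightarrow> span_le (m i, f i) (n, g)"
  have "span_class C M (m i, f i) \<sqsubseteq>\<^bsub>?L\<^esub> span_class C M (n, g)" if "i \<in> I" for i
    using mf[OF that] le[OF that] n(4) le_hom_order_Par_iff[OF _ _ _ n(1-3)] by simp
  then have "span_class C M (n, g) \<in> Upper ?L ((\<lambda>i. span_class C M (m i, f i)) ` I)"
    using carrier n unfolding Upper_def by blast
  then have "span_class C M (k, h) \<sqsubseteq>\<^bsub>?L\<^esub> span_class C M (n, g)" by (rule least)
  then show "span_le (k, h) (n, g)"
    using le_hom_order_Par_iff[OF kh(1-3) n(1-3)] kh(4) n(4) by simp
qed

lemma span_le_self_iff: "span_le (m, m) (n, n) \<longleftrightarrow> factors m n"
  unfolding span_le_def factors_def by auto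

lemma span_le_factors: "span_le (m, f) (n, g) \<Longrightarrow> factors m n"
  unfolding span_le_def factors_def by auto

lemma is_union_unique:
  assumes "is_union I m n" "is_union I m k" "Cod C n = Cod C k"
  shows "factors n k" "factors k n"
  using assms unfolding is_union_def by auto

lemma Ident_M: "X \<in> Ob C \<Longrightarrow> Ident C X \<in> M"
  by (simp add: M_iso iso_Ident)

section \<open>Covering families\<close>

text \<open>Every arrow into \<open>X\<close> factors through the identity, so only leastness
  remains to be checked.\<close>

lemma is_union_IdentI:
  assumes "X \<in> Ob C" "\<And>i. i \<in> I \<Longrightarrow> a i \<in> M \<and> Cod C (a i) = X"
    "\<And>u. \<lbrakk>u \<in> M; Cod C u = X; \<And>i. i \<in> I \<Longrightarrow> factors (a i) u\<rbrakk> \<Longrightarrow> factors (Ident C X) u"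
  shows "is_union I a (Ident C X)"
  using assms unfolding is_union_def by (auto intro: Ident_M factors_Ident)

lemma is_union_IdentD:
  assumes "is_union I a (Ident C X)" "X \<in> Ob C" "u \<in> M" "Cod C u = X" "\<And>i. i \<in> I \<Longrightarrow> factors (a i) u"
  shows "factors (Ident C X) u"
  using assms unfolding is_union_def by auto

text \<open>\<open>L\<close> is tied to the pairs \<open>(i, j)\<close> only by \<open>ab\<close>,
  so any reindexing of the composites fits.\<close>

lemma is_union_Ident_trans:
  assumes X: "X \<in> Ob C" and a: "\<And>i. i \<in> I \<Longrightarrow> a i \<in> M \<and> Cod C (a i) = X"
    and b: "\<And>i j. \<lbrakk>i \<in> I; j \<in> J i\<rbrakk> \<Longrightarrow> b i j \<in> M \<and> Cod C (b i j) = Dom C (a i)"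
    and ua: "is_union I a (Ident C X)"
    and ub: "\<And>i. i \<in> I \<Longrightarrow> is_union (J i) (b i) (Ident C (Dom C (a i)))"
    and c: "\<And>l. l \<in> L \<Longrightarrow> c l \<in> M \<and> Cod C (c l) = X"
    and ab: "\<And>i j. \<lbrakk>i \<in> I; j \<in> J i\<rbrakk> \<Longrightarrow> \<exists>l \<in> L. c l = a i \<cdot> b i j"
  shows "is_union L c (Ident C X)"
proof (rule is_union_IdentI[OF X c])
  fix u assume u: "u \<in> M" "Cod C u = X" and le: "\<And>l. l \<in> L \<Longrightarrow> factors (c l) u"
  show "factors (Ident C X) u"
  proof (rule is_union_IdentD[OF ua X u])
    fix i assume i: "i \<in> I"
    obtain p q where pb: "is_pullback C u (a i) p q"
      using M_pullback[of u "a i"] u a[OF i] by auto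
    note pq = is_pullbackD[OF pb]
    have q: "q \<in> M" using pullback_M[OF pb u(1)] .
    have "factors (Ident C (Dom C (a i))) q"
    proof (rule is_union_IdentD[OF ub[OF i]])
      fix j assume j: "j \<in> J i"
      have "factors (a i \<cdot> b i j) u" using ab[OF i j] le by metis
      then obtain k where k: "k \<in> Ar C" "Dom C k = Dom C (a i \<cdot> b i j)" "Cod C k = Dom C u"
        "u \<cdot> k = a i \<cdot> b i j" by (rule factorsE)
      obtain t where t: "t \<in> Ar C" "Cod C t = Dom C p" "q \<cdot> t = b i j"
        by (rule pullback_factor[OF pb, of k "b i j"]) (use k a[OF i] b[OF i j] in auto)
      show "factors (b i j) q" by (rule factorsI[of t]) (use t pq in auto)
    qed (use pq q in auto)
    then obtain s where s: "s \<in> Ar C" "Dom C s = Dom C (a i)" "Cod C s = Dom C q"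
      "q \<cdot> s = Ident C (Dom C (a i))"
      using pq by (auto elim!: factorsE)
    \<comment> \<open>The right inverse \<open>s\<close> of \<open>q\<close> and the commuting
      square give \<open>u \<cdot> (p \<cdot> s) = a i \<cdot> (q \<cdot> s) = a i\<close>.\<close>
    have "u \<cdot> (p \<cdot> s) = (u \<cdot> p) \<cdot> s" using s pq by (subst assoc) auto
    also have "\<dots> = a i \<cdot> (q \<cdot> s)" unfolding pq(9) using s(1-3) pq by (subst assoc) auto
    finally have "u \<cdot> (p \<cdot> s) = a i" using s pq by simp
    then show "factors (a i) u"
      by (intro factorsI[of "p \<cdot> s"]) (use s pq in auto)
  qed
qed

lemma basic_covers_iff:
  assumes "X \<in> Ob C"
  shows "(I, a) \<in> basic_covers C M X \<longleftrightarrow>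
    (\<forall>i \<in> I. a i \<in> M \<and> Cod C (a i) = X) \<and> is_union I a (Ident C X)"
  using is_join_Sub_iff[of I a X "Ident C X"] assms Ident_M unfolding basic_covers_def by auto

end

section \<open>Consequences of the join axioms\<close>

context geometric_M_category
begin

text \<open>Compatibility of the spans \<open>(m i, f i)\<close> follows from agreement of the
  \<open>f i\<close> on pairwise pullbacks. The lemma collects what the join \<open>(k, h)\<close>
  then provides: that \<open>k\<close> is a union is (J1), and the last clause is (J2) for the total
  map \<open>(1, g)\<close>.\<close>

lemma matching_spans_join:
  assumes "A \<in> Ob C" "B \<in> Ob C"
    and mf: "\<And>i. i \<in> I \<Longrightarrow> m i \<in> M \<and> f i \<in> Ar C \<and> Dom C (f i) = Dom C (m i) \<and>
      Cod C (m i) = A \<and> Cod C (f i) = B"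
    and matching: "\<And>i j p q. \<lbrakk>i \<in> I; j \<in> I; i \<noteq> j; is_pullback C (m i) (m j) p q\<rbrakk>
      \<Longrightarrow> f i \<cdot> p = f j \<cdot> q"
  obtains k h where "k \<in> M" "h \<in> Ar C" "Dom C h = Dom C k" "Cod C k = A" "Cod C h = B"
    "is_union I m k" "\<And>i. i \<in> I \<Longrightarrow> span_le (m i, f i) (k, h)"
    "\<And>n g. \<lbrakk>n \<in> M; g \<in> Ar C; Dom C g = Dom C n; Cod C n = A; Cod C g = B;
      \<And>i. i \<in> I \<Longrightarrow> span_le (m i, f i) (n, g)\<rbrakk> \<Longrightarrow> span_le (k, h) (n, g)"
    "\<And>g. \<lbrakk>g \<in> Ar C; Cod C g = A\<rbrakk> \<Longrightarrow>
      is_join (hom_order (Par C M) Par_rst (Dom C g) B)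
        ((\<lambda>i. span_class C M (m i, f i) \<cdot>\<^bsub>Par C M\<^esub> span_class C M (Ident C (Dom C g), g)) ` I)
        (span_class C M (k, h) \<cdot>\<^bsub>Par C M\<^esub> span_class C M (Ident C (Dom C g), g))"
proof -
  interpret P: join_restriction_category "Par C M" Par_rst by (rule geometric)
  let ?S = "(\<lambda>i. span_class C M (m i, f i)) ` I"
  have S: "?S \<subseteq> hom (Par C M) A B" using mf span_class_hom_Par by fastforce
  \<comment> \<open>Composing with the restriction of the other span pulls back along it. The sides
    are \<open>(m j \<cdot> q, f i \<cdot> p)\<close> and
    \<open>(m i \<cdot> p, f j \<cdot> q)\<close>, equal by the pullback square and by
    \<open>matching\<close>.\<close>
  have "span_class C M (m i, f i) \<cdot>\<^bsub>Par C M\<^esub> Par_rst (span_class C M (m j, f j)) =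
      span_class C M (m j, f j) \<cdot>\<^bsub>Par C M\<^esub> Par_rst (span_class C M (m i, f i))"
    if ij: "i \<in> I" "j \<in> I" "i \<noteq> j" for i j
  proof -
    obtain p q where pb: "is_pullback C (m i) (m j) p q"
      using M_pullback[of "m i" "m j"] mf ij by auto
    show ?thesis
      using comp_Par[OF _ _ _ _ _ _ pb, of "m j" "f i"] matching[OF ij pb] is_pullbackD(9)[OF pb]
        comp_Par[OF _ _ _ _ _ _ pullback_sym[OF pb], of "m i" "f j"] mf[OF ij(1)] mf[OF ij(2)]
      by (simp add: Par_rst_span_class)
  qed
  then have "compatible_set (Par C M) Par_rst ?S"
    unfolding compatible_set_def by force
  then obtain x where x: "is_join (hom_order (Par C M) Par_rst A B) ?S x"
    "is_join (hom_order (Par C M) Par_rst A A) (Par_rst ` ?S) (Par_rst x)"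
    "\<And>A' g. g \<in> hom (Par C M) A' A \<Longrightarrow> A' \<in> Ob C \<Longrightarrow>
      is_join (hom_order (Par C M) Par_rst A' B) ((\<lambda>s. s \<cdot>\<^bsub>Par C M\<^esub> g) ` ?S) (x \<cdot>\<^bsub>Par C M\<^esub> g)"
    using P.joins[OF _ _ S] assms(1,2) by auto
  have "x \<in> hom (Par C M) A B"
    using x(1) unfolding is_join_def least_def Upper_def by (auto simp: hom_order_def simp del: hom_iff)
  then obtain k h where kh: "k \<in> M" "h \<in> Ar C" "Dom C h = Dom C k" "Cod C k = A" "Cod C h = B"
    and xkh: "x = span_class C M (k, h)" by (rule hom_ParE)
  \<comment> \<open>The restrictions are the spans \<open>(m i, m i)\<close> and
    \<open>(k, k)\<close>, on which \<open>span_le\<close> is just \<open>factors\<close>; so (J1)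
    turns into a statement about unions.\<close>
  have "Par_rst ` ?S = (\<lambda>i. span_class C M (m i, m i)) ` I"
    unfolding image_image using mf by (intro image_cong) (auto simp: Par_rst_span_class)
  then have J1: "is_join (hom_order (Par C M) Par_rst A A) ((\<lambda>i. span_class C M (m i, m i)) ` I)
      (span_class C M (k, k))"
    using x(2) kh by (simp add: xkh Par_rst_span_class)
  have mm: "m i \<in> M \<and> m i \<in> Ar C \<and> Dom C (m i) = Dom C (m i) \<and> Cod C (m i) = A \<and> Cod C (m i) = A"
    if "i \<in> I" for i using mf[OF that] by simp
  have "factors (m i) k" if "i \<in> I" for i
    using is_join_ParD(1)[OF mm _ _ _ _ _ J1 that] kh by (auto simp: span_le_self_iff)
  moreover have "factors k u" if "u \<in> M" "Cod C u = Cod C k" "\<forall>i \<in> I. factors (m i) u" for u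
    using is_join_ParD(2)[OF mm _ _ _ _ _ J1, of u u] that kh by (auto simp: span_le_self_iff)
  ultimately have union: "is_union I m k"
    using kh(1) unfolding is_union_def by blast
  have J2: "is_join (hom_order (Par C M) Par_rst (Dom C g) B)
        ((\<lambda>i. span_class C M (m i, f i) \<cdot>\<^bsub>Par C M\<^esub> span_class C M (Ident C (Dom C g), g)) ` I)
        (span_class C M (k, h) \<cdot>\<^bsub>Par C M\<^esub> span_class C M (Ident C (Dom C g), g))"
    if "g \<in> Ar C" "Cod C g = A" for g
    using x(3)[of "span_class C M (Ident C (Dom C g), g)" "Dom C g"]
      span_class_hom_Par[of "Ident C (Dom C g)" g] Ident_M that
    by (simp add: xkh image_image del: hom_iff)
  show thesis
    by (rule that[OF kh union is_join_ParD[OF mf kh x(1)[unfolded xkh]] J2])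
qed

text \<open>With \<open>f = m\<close> the pullback squares themselves make the family matching, so
  the join exists and its first leg is a union.\<close>

lemma is_union_exists:
  assumes "A \<in> Ob C" "\<And>i. i \<in> I \<Longrightarrow> m i \<in> M \<and> Cod C (m i) = A"
  obtains n where "is_union I m n" "Cod C n = A"
proof -
  obtain n where "is_union I m n" "Cod C n = A"
    by (rule matching_spans_join[of A A I m m])
      (use assms in \<open>auto dest: is_pullbackD(9)\<close>)
  then show thesis by (rule that)
qed

text \<open>The join \<open>(k, g)\<close> of the spans \<open>(m i, f i)\<close> has a union
  \<open>k\<close> as its first leg, so \<open>n\<close> factors through \<open>k\<close> by some
  \<open>t\<close>, and the glued map is \<open>g \<cdot> t\<close>.\<close>

lemma is_union_glue:
  assumes un: "is_union I m n" and "Y \<in> Ob C"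
    and m: "\<And>i. i \<in> I \<Longrightarrow> m i \<in> M \<and> Cod C (m i) = Cod C n"
    and b: "\<And>i. i \<in> I \<Longrightarrow> b i \<in> Ar C \<and> Dom C (b i) = Dom C (m i) \<and> Cod C (b i) = Dom C n \<and> n \<cdot> b i = m i"
    and f: "\<And>i. i \<in> I \<Longrightarrow> f i \<in> Ar C \<and> Dom C (f i) = Dom C (m i) \<and> Cod C (f i) = Y"
    and matching: "\<And>i j p q. \<lbrakk>i \<in> I; j \<in> I; i \<noteq> j; is_pullback C (m i) (m j) p q\<rbrakk>
      \<Longrightarrow> f i \<cdot> p = f j \<cdot> q"
  shows "\<exists>!h. h \<in> hom C (Dom C n) Y \<and> (\<forall>i \<in> I. h \<cdot> b i = f i)"
proof -
  have n: "n \<in> M" using un unfolding is_union_def by blast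
  obtain k g where kg: "k \<in> M" "g \<in> Ar C" "Dom C g = Dom C k" "Cod C k = Cod C n" "Cod C g = Y"
    and uk: "is_union I m k" and le: "\<And>i. i \<in> I \<Longrightarrow> span_le (m i, f i) (k, g)"
    and least: "\<And>n' g'. \<lbrakk>n' \<in> M; g' \<in> Ar C; Dom C g' = Dom C n'; Cod C n' = Cod C n; Cod C g' = Y;
      \<And>i. i \<in> I \<Longrightarrow> span_le (m i, f i) (n', g')\<rbrakk> \<Longrightarrow> span_le (k, g) (n', g')"
    by (rule matching_spans_join[of "Cod C n" Y I m f])
      (use n assms(2) m f matching in auto)
  have "factors n k" using is_union_unique[OF un uk] kg by simp
  then obtain t where t: "t \<in> Ar C" "Dom C t = Dom C n" "Cod C t = Dom C k" "k \<cdot> t = n"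
    by (rule factorsE)
  show ?thesis
  proof (rule ex1I[of _ "g \<cdot> t"])
    have "(g \<cdot> t) \<cdot> b i = f i" if i: "i \<in> I" for i
    proof -
      obtain c where c: "c \<in> Ar C" "Dom C c = Dom C (m i)" "Cod C c = Dom C k" "k \<cdot> c = m i" "g \<cdot> c = f i"
        using le[OF i] unfolding span_le_def by auto
      \<comment> \<open>Both \<open>t \<cdot> b i\<close> and the factor \<open>c\<close> supplied
        by the join are factors of \<open>m i\<close> through the monic \<open>k\<close>, so they
        coincide.\<close>
      have "k \<cdot> (t \<cdot> b i) = (k \<cdot> t) \<cdot> b i"
        using t(1-3) b[OF i] kg by (subst assoc) auto
      then have "k \<cdot> (t \<cdot> b i) = k \<cdot> c" using b[OF i] c t by simp
      then have "t \<cdot> b i = c"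
        by (rule M_cancel[OF kg(1)]) (use b[OF i] c(1-3) t(1-3) kg in auto)
      then show ?thesis using c t(1-3) b[OF i] kg by (simp add: assoc)
    qed
    then show "g \<cdot> t \<in> hom C (Dom C n) Y \<and> (\<forall>i \<in> I. (g \<cdot> t) \<cdot> b i = f i)"
      using kg t(1-3) by auto
  next
    fix h assume h: "h \<in> hom C (Dom C n) Y \<and> (\<forall>i \<in> I. h \<cdot> b i = f i)"
    \<comment> \<open>Any solution \<open>h\<close> makes \<open>(n, h)\<close> an upper bound, so
      by leastness \<open>g = h \<cdot> s\<close> for some \<open>s\<close> with
      \<open>n \<cdot> s = k\<close>. Cancelling \<open>n\<close> gives
      \<open>s \<cdot> t = 1\<close>, whence \<open>h = g \<cdot> t\<close>.\<close>
    have "span_le (m i, f i) (n, h)" if i: "i \<in> I" for i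
      unfolding span_le_def using b[OF i] h i by auto
    then have "span_le (k, g) (n, h)" using h n by (intro least) auto
    then obtain s where s: "s \<in> Ar C" "Dom C s = Dom C k" "Cod C s = Dom C n" "n \<cdot> s = k" "h \<cdot> s = g"
      unfolding span_le_def by auto
    have "n \<cdot> (s \<cdot> t) = (n \<cdot> s) \<cdot> t" using s(1-3) t(1-3) n by (subst assoc) auto
    then have "n \<cdot> (s \<cdot> t) = n \<cdot> Ident C (Dom C n)" using s t n by simp
    then have "s \<cdot> t = Ident C (Dom C n)"
      by (rule M_cancel[OF n]) (use s(1-3) t(1-3) n in auto)
    moreover have "(h \<cdot> s) \<cdot> t = h \<cdot> (s \<cdot> t)" using s(1-3) t(1-3) h by (subst assoc) auto
    ultimately show "h = g \<cdot> t" using h s(5) by simp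
  qed
qed

text \<open>Precomposing the spans \<open>(a i, a i)\<close> with \<open>(1, g)\<close> yields
  \<open>(b i, a i \<cdot> p i)\<close>. By (J2) their join is \<open>(q0, h \<cdot> p0)\<close>,
  where \<open>q0\<close> is the pullback along \<open>g\<close> of the union \<open>k\<close> of
  the \<open>a i\<close>. So \<open>q0\<close> lies below every bound of the \<open>b i\<close>, and
  it has a right inverse because \<open>k\<close> has one.\<close>

lemma is_union_Ident_pullback:
  assumes a: "\<And>i. i \<in> I \<Longrightarrow> a i \<in> M \<and> Cod C (a i) = Cod C g" and g: "g \<in> Ar C"
    and un: "is_union I a (Ident C (Cod C g))"
    and pb: "\<And>i. i \<in> I \<Longrightarrow> is_pullback C (a i) g (p i) (b i)"
  shows "is_union I b (Ident C (Dom C g))"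
proof (rule is_union_IdentI)
  note pbD = is_pullbackD[OF pb]
  have b: "b i \<in> M \<and> Cod C (b i) = Dom C g" if "i \<in> I" for i
    using pullback_M[OF pb] a pbD that by blast
  fix u assume u: "u \<in> M" "Cod C u = Dom C g" and le: "\<And>i. i \<in> I \<Longrightarrow> factors (b i) u"
  obtain k h where kh: "k \<in> M" "h \<in> Ar C" "Dom C h = Dom C k" "Cod C k = Cod C g" "Cod C h = Cod C g"
    and uk: "is_union I a k"
    and join: "is_join (hom_order (Par C M) Par_rst (Dom C g) (Cod C g))
        ((\<lambda>i. span_class C M (a i, a i) \<cdot>\<^bsub>Par C M\<^esub> span_class C M (Ident C (Dom C g), g)) ` I)
        (span_class C M (k, h) \<cdot>\<^bsub>Par C M\<^esub> span_class C M (Ident C (Dom C g), g))"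
    by (rule matching_spans_join[of "Cod C g" "Cod C g" I a a])
      (use a g in \<open>auto dest: is_pullbackD(9)\<close>)
  obtain p0 q0 where pb0: "is_pullback C k g p0 q0" using M_pullback[OF kh(1) g] kh(4) by auto
  note pq0 = is_pullbackD[OF pb0]
  have q0: "q0 \<in> M" using pullback_M[OF pb0 kh(1)] .
  have "span_class C M (k, h) \<cdot>\<^bsub>Par C M\<^esub> span_class C M (Ident C (Dom C g), g) =
      span_class C M (q0, h \<cdot> p0)"
    using comp_Par[OF _ _ _ kh(1-3) pb0] Ident_M g pq0 by simp
  moreover have "span_class C M (a i, a i) \<cdot>\<^bsub>Par C M\<^esub> span_class C M (Ident C (Dom C g), g) =
      span_class C M (b i, a i \<cdot> p i)" if "i \<in> I" for i
    using comp_Par[OF _ _ _ _ _ _ pb[OF that]] Ident_M g pbD[OF that] a[OF that] by simp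
  ultimately have join': "is_join (hom_order (Par C M) Par_rst (Dom C g) (Cod C g))
        ((\<lambda>i. span_class C M (b i, a i \<cdot> p i)) ` I) (span_class C M (q0, h \<cdot> p0))"
    using join by (simp cong: image_cong)
  \<comment> \<open>Leastness compares spans, so the subobject \<open>u\<close> needs a second leg;
    \<open>g \<cdot> u\<close> is suitable because
    \<open>a i \<cdot> p i = g \<cdot> b i\<close>.\<close>
  have "span_le (q0, h \<cdot> p0) (u, g \<cdot> u)"
  proof (rule is_join_ParD(2)[OF _ _ _ _ _ _ join'])
    fix i assume i: "i \<in> I"
    obtain t where t: "t \<in> Ar C" "Dom C t = Dom C (b i)" "Cod C t = Dom C u" "u \<cdot> t = b i"
      using le[OF i] by (rule factorsE)
    then show "span_le (b i, a i \<cdot> p i) (u, g \<cdot> u)"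
      unfolding span_le_def using pbD[OF i] u g by (auto simp: assoc)
    show "b i \<in> M \<and> a i \<cdot> p i \<in> Ar C \<and> Dom C (a i \<cdot> p i) = Dom C (b i) \<and> Cod C (b i) = Dom C g \<and>
        Cod C (a i \<cdot> p i) = Cod C g"
      using b[OF i] pbD[OF i] by simp
  qed (use q0 pq0 kh u g in auto)
  then have "factors q0 u" by (rule span_le_factors)
  moreover have "factors (Ident C (Dom C g)) q0"
  proof -
    have "factors (Ident C (Cod C g)) k" using is_union_unique[OF un uk] kh(4) g by simp
    then obtain t where t: "t \<in> Ar C" "Dom C t = Cod C g" "Cod C t = Dom C k"
      "k \<cdot> t = Ident C (Cod C g)" using g by (auto elim!: factorsE)
    \<comment> \<open>As \<open>t\<close> is a right inverse of \<open>k\<close>, the maps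
      \<open>t \<cdot> g\<close> and the identity form a cone over \<open>k\<close> and
      \<open>g\<close>; the mediating map \<open>s\<close> is a right inverse of
      \<open>q0\<close>.\<close>
    have "k \<cdot> (t \<cdot> g) = (k \<cdot> t) \<cdot> g" using t(1-3) kh(1) g by (subst assoc) auto
    then obtain s where "s \<in> Ar C" "Cod C s = Dom C p0" "q0 \<cdot> s = Ident C (Dom C g)"
      using pullback_factor[OF pb0, of "t \<cdot> g" "Ident C (Dom C g)"] t g by auto
    then show ?thesis by (intro factorsI[of s]) (use pq0 in auto)
  qed
  ultimately show "factors (Ident C (Dom C g)) u" using factors_trans u by auto
qed (use pullback_M[OF pb] is_pullbackD[OF pb] a g in auto)

end

section \<open>Matching diagrams\<close>

context category
begin

lemma pullback_choiceD:
  assumes "pullback_choice C I m pm" "i \<in> I" "j \<in> I" "i \<noteq> j"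
  shows "is_pullback C (m i) (m j) (pm j i) (pm i j)" "Dom C (pm j i) = Dom C (pm i j)"
proof -
  show *: "is_pullback C (m i) (m j) (pm j i) (pm i j)"
    using assms unfolding pullback_choice_def by blast
  show "Dom C (pm j i) = Dom C (pm i j)" using is_pullbackD(6)[OF *] by simp
qed

lemma ObMap_Piece: "ObMap (matching_diagram C I m pm) (Piece i) = Dom C (m i)"
  by (simp add: matching_diagram_def)

text \<open>The pair has the two orderings \<open>(i, j)\<close> and \<open>(j, i)\<close>, and
  \<open>pm i j\<close> and \<open>pm j i\<close> are projections from one apex, so the
  \<open>THE\<close> description has a single value.\<close>

lemma ObMap_Overlap:
  assumes "pullback_choice C I m pm" "i \<in> I" "j \<in> I" "i \<noteq> j"
  shows "ObMap (matching_diagram C I m pm) (Overlap {i, j}) = Dom C (pm i j)"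
proof -
  have "(THE P. \<exists>i' j'. i' \<noteq> j' \<and> {i, j} = {i', j'} \<and> P = Dom C (pm i' j')) = Dom C (pm i j)"
    using assms(4) pullback_choiceD(2)[OF assms] by (intro the_equality) (auto simp: doubleton_eq_iff)
  then show ?thesis by (simp add: matching_diagram_def)
qed

lemma Verts_matching_diagram:
  "(\<forall>v \<in> Verts (matching_diagram C I m pm). P v) \<longleftrightarrow>
    (\<forall>i \<in> I. P (Piece i)) \<and> (\<forall>i \<in> I. \<forall>j \<in> I. i \<noteq> j \<longrightarrow> P (Overlap {i, j}))"
  by (auto simp: matching_diagram_def)

lemma Edges_matching_diagram:
  "(\<forall>e \<in> Edges (matching_diagram C I m pm). P e) \<longleftrightarrow> (\<forall>i \<in> I. \<forall>j \<in> I. i \<noteq> j \<longrightarrow> P (i, j))"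
  by (auto simp: matching_diagram_def)

lemma edge_matching_diagram:
  "Source (matching_diagram C I m pm) (i, j) = Overlap {i, j}"
  "Target (matching_diagram C I m pm) (i, j) = Piece j"
  "ArMap (matching_diagram C I m pm) (i, j) = pm i j"
  by (simp_all add: matching_diagram_def)

lemma is_diagram_matching_diagram:
  assumes "pullback_choice C I m pm" "\<And>i. i \<in> I \<Longrightarrow> m i \<in> Ar C"
  shows "is_diagram C (matching_diagram C I m pm)"
proof -
  have "pm i j \<in> Ar C \<and> Cod C (pm i j) = Dom C (m j)" if "i \<in> I" "j \<in> I" "i \<noteq> j" for i j
    using is_pullbackD(4,8)[OF pullback_choiceD(1)[OF assms(1) that]] by simp
  moreover have "Piece i \<in> Verts (matching_diagram C I m pm)" if "i \<in> I" for i
    using that by (auto simp: matching_diagram_def)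
  moreover have "Overlap {i, j} \<in> Verts (matching_diagram C I m pm)" if "i \<in> I" "j \<in> I" "i \<noteq> j" for i j
    using that by (auto simp: matching_diagram_def)
  ultimately show ?thesis
    unfolding is_diagram_def Verts_matching_diagram Edges_matching_diagram edge_matching_diagram
    using assms(2) by (simp add: ObMap_Piece ObMap_Overlap[OF assms(1)])
qed

text \<open>The edge equations already give the legs at the overlaps their types. As
  \<open>{i, j}\<close> is unordered, these equations for both orderings express that the legs at
  the pieces agree on each overlap.\<close>

lemma is_cocone_matching_diagram:
  assumes "pullback_choice C I m pm"
  shows "is_cocone C (matching_diagram C I m pm) Y l \<longleftrightarrow> Y \<in> Ob C \<and>
    (\<forall>i \<in> I. l (Piece i) \<in> hom C (Dom C (m i)) Y) \<and>
    (\<forall>i \<in> I. \<forall>j \<in> I. i \<noteq> j \<longrightarrow> l (Piece j) \<cdot> pm i j = l (Overlap {i, j}))" (is "_ \<longleftrightarrow> ?R")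
proof -
  have "l (Overlap {i, j}) \<in> hom C (Dom C (pm i j)) Y"
    if "?R" "i \<in> I" "j \<in> I" "i \<noteq> j" for i j
  proof -
    have "l (Piece j) \<cdot> pm i j = l (Overlap {i, j})" "l (Piece j) \<in> hom C (Dom C (m j)) Y"
      using that by blast+
    then show ?thesis
      using is_pullbackD(4,8)[OF pullback_choiceD(1)[OF assms that(2-)]] comp_simps[of "pm i j" "l (Piece j)"]
      by simp
  qed
  then show ?thesis
    unfolding is_cocone_def Verts_matching_diagram Edges_matching_diagram edge_matching_diagram
    by (auto simp: ObMap_Piece ObMap_Overlap[OF assms] simp del: hom_iff)
qed

end

lemma (in M_category) pullback_choice_exists:
  assumes m: "\<And>i. i \<in> I \<Longrightarrow> m i \<in> M \<and> Cod C (m i) = A"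
  obtains pm where "pullback_choice C I m pm"
proof -
  \<comment> \<open>Indexing the choice by the unordered pair \<open>e\<close> makes \<open>(i, j)\<close> and \<open>(j, i)\<close> use the same pullback.\<close>
  have "\<exists>t. \<forall>i \<in> I. \<forall>j \<in> I. i \<noteq> j \<longrightarrow> e = {i, j} \<longrightarrow> is_pullback C (m i) (m j) (t i) (t j)" for e
  proof (cases "\<exists>i \<in> I. \<exists>j \<in> I. i \<noteq> j \<and> e = {i, j}")
    case True
    then obtain i j where ij: "i \<in> I" "j \<in> I" "i \<noteq> j" "e = {i, j}" by blast
    obtain p q where pb: "is_pullback C (m i) (m j) p q"
      using M_pullback[of "m i" "m j"] m ij by auto
    show ?thesis
      by (rule exI[of _ "\<lambda>x. if x = i then p else q"])
        (use ij pb pullback_sym[OF pb] in \<open>auto simp: doubleton_eq_iff\<close>)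
  qed blast
  then obtain t where t: "\<And>e i j. \<lbrakk>i \<in> I; j \<in> I; i \<noteq> j; e = {i, j}\<rbrakk>
      \<Longrightarrow> is_pullback C (m i) (m j) (t e i) (t e j)"
    by metis
  have "pullback_choice C I m (\<lambda>i j. t {i, j} j)"
    unfolding pullback_choice_def using t by (metis insert_commute)
  then show thesis by (rule that)
qed

section \<open>Unions as colimits of matching diagrams\<close>

context geometric_M_category
begin

text \<open>A cocone is a family on the pieces that agrees on the overlaps, and
  \<open>is_union_glue\<close> extends such a family uniquely to the domain of
  \<open>n\<close>.\<close>

lemma union_is_colimit:
  assumes un: "is_union I m n"
    and m: "\<And>i. i \<in> I \<Longrightarrow> m i \<in> M \<and> Cod C (m i) = Cod C n"
    and b: "\<And>i. i \<in> I \<Longrightarrow> b i \<in> Ar C \<and> Dom C (b i) = Dom C (m i) \<and> Cod C (b i) = Dom C n \<and> n \<cdot> b i = m i"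
    and pc: "pullback_choice C I m pm"
  obtains l where "is_colimit C (matching_diagram C I m pm) (Dom C n) l"
    "\<And>i. i \<in> I \<Longrightarrow> l (Piece i) = b i"
proof -
  let ?D = "matching_diagram C I m pm"
  have n: "n \<in> M" using un unfolding is_union_def by blast
  note pb = pullback_choiceD(1)[OF pc]
  note pq = is_pullbackD[OF pb]
  \<comment> \<open>Cancelling the monic \<open>n\<close> shows that the two orderings of a pair
    give the same map on the overlap, so a leg at the unordered vertex makes sense.\<close>
  have sym: "b i \<cdot> pm j i = b j \<cdot> pm i j" if ij: "i \<in> I" "j \<in> I" "i \<noteq> j" for i j
  proof -
    have "n \<cdot> (b i \<cdot> pm j i) = (n \<cdot> b i) \<cdot> pm j i"
      using b[OF ij(1)] pq[OF ij] n by (subst assoc) auto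
    also have "\<dots> = (n \<cdot> b j) \<cdot> pm i j" using b ij pq(9)[OF ij] by simp
    also have "\<dots> = n \<cdot> (b j \<cdot> pm i j)"
      using b[OF ij(2)] pq[OF ij] n by (subst assoc) auto
    finally show ?thesis
      by (rule M_cancel[OF n]) (use b[OF ij(1)] b[OF ij(2)] pq[OF ij] in auto)
  qed
  \<comment> \<open>\<open>SOME\<close> picks an ordering of the pair; by \<open>sym\<close> either
    choice gives the same leg.\<close>
  define l where "l v = (case v of Piece i \<Rightarrow> b i
    | Overlap e \<Rightarrow> (SOME x. \<exists>i \<in> I. \<exists>j \<in> I. i \<noteq> j \<and> e = {i, j} \<and> x = b j \<cdot> pm i j))" for v
  have lP: "l (Piece i) = b i" for i by (simp add: l_def)
  have lO: "l (Overlap {i, j}) = b j \<cdot> pm i j" if ij: "i \<in> I" "j \<in> I" "i \<noteq> j" for i j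
  proof -
    have "\<exists>x. \<exists>i' \<in> I. \<exists>j' \<in> I. i' \<noteq> j' \<and> {i, j} = {i', j'} \<and> x = b j' \<cdot> pm i' j'" using ij by blast
    from someI_ex[OF this] obtain i' j' where "{i, j} = {i', j'}" "l (Overlap {i, j}) = b j' \<cdot> pm i' j'"
      unfolding l_def by auto
    then show ?thesis using sym[OF ij] by (auto simp: doubleton_eq_iff)
  qed
  have "\<exists>!h. h \<in> hom C (Dom C n) Y \<and> (\<forall>v \<in> Verts ?D. h \<cdot> l v = l' v)" if cc: "is_cocone C ?D Y l'" for Y l'
  proof -
    have Y: "Y \<in> Ob C"
      and l'P: "\<And>i. i \<in> I \<Longrightarrow> l' (Piece i) \<in> Ar C \<and> Dom C (l' (Piece i)) = Dom C (m i) \<and> Cod C (l' (Piece i)) = Y"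
      and l'O: "\<And>i j. \<lbrakk>i \<in> I; j \<in> I; i \<noteq> j\<rbrakk> \<Longrightarrow> l' (Overlap {i, j}) = l' (Piece j) \<cdot> pm i j"
      using cc unfolding is_cocone_matching_diagram[OF pc] by auto
    have ex: "\<exists>!h. h \<in> hom C (Dom C n) Y \<and> (\<forall>i \<in> I. h \<cdot> b i = l' (Piece i))"
    proof (rule is_union_glue[OF un Y m b l'P])
      fix i j p q assume ij: "i \<in> I" "j \<in> I" "i \<noteq> j" and pb': "is_pullback C (m i) (m j) p q"
      \<comment> \<open>The cocone gives agreement on the chosen pullback only; the comparison map
        \<open>h\<close> carries it to an arbitrary pullback \<open>p\<close>,
        \<open>q\<close>.\<close>
      obtain h where h: "h \<in> Ar C" "Cod C h = Dom C (pm j i)" "p = pm j i \<cdot> h" "q = pm i j \<cdot> h"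
        using pullback_iso[OF pb[OF ij] pb'] by metis
      have "l' (Piece i) \<cdot> pm j i = l' (Piece j) \<cdot> pm i j"
        using l'O[OF ij] l'O[of j i] ij by (simp add: insert_commute)
      then have "(l' (Piece i) \<cdot> pm j i) \<cdot> h = (l' (Piece j) \<cdot> pm i j) \<cdot> h" by simp
      then show "l' (Piece i) \<cdot> p = l' (Piece j) \<cdot> q"
        unfolding h(3,4) using l'P[OF ij(1)] l'P[OF ij(2)] h(1,2) pq[OF ij] by (simp add: assoc)
    qed
    have "h \<cdot> l (Overlap {i, j}) = l' (Overlap {i, j})"
      if h: "h \<in> hom C (Dom C n) Y" "\<forall>i \<in> I. h \<cdot> b i = l' (Piece i)" and ij: "i \<in> I" "j \<in> I" "i \<noteq> j" for h i j
    proof -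
      have "h \<cdot> (b j \<cdot> pm i j) = (h \<cdot> b j) \<cdot> pm i j"
        using h(1) b[OF ij(2)] pq[OF ij] by (subst assoc) auto
      then show ?thesis using h(2) ij by (simp add: lO l'O)
    qed
    then have "h \<in> hom C (Dom C n) Y \<and> (\<forall>v \<in> Verts ?D. h \<cdot> l v = l' v) \<longleftrightarrow>
        h \<in> hom C (Dom C n) Y \<and> (\<forall>i \<in> I. h \<cdot> b i = l' (Piece i))" for h
      unfolding Verts_matching_diagram lP by blast
    then show ?thesis using ex by (simp only:)
  qed
  moreover have "is_diagram C ?D" using is_diagram_matching_diagram[OF pc] m by simp
  moreover have "is_cocone C ?D (Dom C n) l"
    unfolding is_cocone_matching_diagram[OF pc] lP using b n lO by auto
  ultimately have "is_colimit C ?D (Dom C n) l" unfolding is_colimit_def by blast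
  then show thesis using lP that by blast
qed

text \<open>A basic cover is its own family of subobjects, with \<open>m = a\<close> and
  \<open>A = X\<close>. Conversely, comparing \<open>X\<close> with the domain of the union
  \<open>n\<close> gives an isomorphism \<open>h\<close>; with its inverse \<open>g\<close>, the map
  \<open>n \<cdot> g\<close> exhibits \<open>X\<close> as a subobject of \<open>A\<close> and
  carries \<open>a i\<close> to \<open>m i\<close>.\<close>

lemma basic_cover_iff_colimit:
  assumes X: "X \<in> Ob C"
  shows "(I, a) \<in> basic_covers C M X \<longleftrightarrow>
    (\<exists>A \<in> Ob C. \<exists>m. (\<forall>i \<in> I. m i \<in> M \<and> Dom C (m i) = Dom C (a i) \<and> Cod C (m i) = A) \<and>
      colimit_of_matching_diagram C I m X a)"
proof
  assume "(I, a) \<in> basic_covers C M X"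
  then have a: "\<And>i. i \<in> I \<Longrightarrow> a i \<in> M \<and> Cod C (a i) = X" and un: "is_union I a (Ident C X)"
    unfolding basic_covers_iff[OF X] by auto
  obtain pm where pc: "pullback_choice C I a pm" by (rule pullback_choice_exists[OF a])
  obtain l where "is_colimit C (matching_diagram C I a pm) (Dom C (Ident C X)) l"
    "\<And>i. i \<in> I \<Longrightarrow> l (Piece i) = a i"
    by (rule union_is_colimit[OF un _ _ pc, of a]) (use a X in auto)
  then have "colimit_of_matching_diagram C I a X a"
    unfolding colimit_of_matching_diagram_def using pc X by auto
  then show "\<exists>A \<in> Ob C. \<exists>m. (\<forall>i \<in> I. m i \<in> M \<and> Dom C (m i) = Dom C (a i) \<and> Cod C (m i) = A) \<and>
      colimit_of_matching_diagram C I m X a"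
    using X a by blast
next
  assume "\<exists>A \<in> Ob C. \<exists>m. (\<forall>i \<in> I. m i \<in> M \<and> Dom C (m i) = Dom C (a i) \<and> Cod C (m i) = A) \<and>
      colimit_of_matching_diagram C I m X a"
  then obtain A m pm l where A: "A \<in> Ob C"
    and m: "\<And>i. i \<in> I \<Longrightarrow> m i \<in> M \<and> Dom C (m i) = Dom C (a i) \<and> Cod C (m i) = A"
    and pc: "pullback_choice C I m pm" and col: "is_colimit C (matching_diagram C I m pm) X l"
    and l: "\<And>i. i \<in> I \<Longrightarrow> l (Piece i) = a i"
    unfolding colimit_of_matching_diagram_def by blast
  obtain n where un: "is_union I m n" and nA: "Cod C n = A"
    by (rule is_union_exists[OF A, of I m]) (use m in auto)
  have n: "n \<in> M" using un unfolding is_union_def by blast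
  have "\<forall>i. \<exists>b. i \<in> I \<longrightarrow> b \<in> Ar C \<and> Dom C b = Dom C (m i) \<and> Cod C b = Dom C n \<and> n \<cdot> b = m i"
    using un unfolding is_union_def factors_def by blast
  then obtain b where b: "\<And>i. i \<in> I \<Longrightarrow>
      b i \<in> Ar C \<and> Dom C (b i) = Dom C (m i) \<and> Cod C (b i) = Dom C n \<and> n \<cdot> b i = m i"
    by metis
  obtain l' where col': "is_colimit C (matching_diagram C I m pm) (Dom C n) l'"
    and l': "\<And>i. i \<in> I \<Longrightarrow> l' (Piece i) = b i"
    by (rule union_is_colimit[OF un _ b pc]) (use m nA in auto)
  obtain h where h: "is_iso C h" "Dom C h = Dom C n" "Cod C h = X"
    and hl: "\<And>v. v \<in> Verts (matching_diagram C I m pm) \<Longrightarrow> h \<cdot> l' v = l v"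
    using colimit_iso[OF col' col] by blast
  have hb: "h \<cdot> b i = a i" if "i \<in> I" for i
    using hl[of "Piece i"] that l l' by (auto simp: matching_diagram_def)
  obtain g where "h \<in> Ar C" "g \<in> Ar C" "Dom C g = Cod C h" "Cod C g = Dom C h"
    "g \<cdot> h = Ident C (Dom C h)" "is_iso C g"
    using h(1) by (rule isoE)
  note g = this[unfolded h(2,3)]
  have a: "a i \<in> M \<and> Cod C (a i) = X" if i: "i \<in> I" for i
  proof -
    \<comment> \<open>\<open>b i\<close> is a factor of \<open>m i \<in> M\<close> through
      \<open>n \<in> M\<close>, and \<open>a i\<close> differs from it by the isomorphism
      \<open>h\<close>.\<close>
    have "b i \<in> M" using M_cancel_left[OF n, of "b i"] b[OF i] m[OF i] by simp
    then show ?thesis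
      using M_comp[of "b i" h] M_iso[OF h(1)] b[OF i] g h(2,3) hb[OF i, symmetric] by simp
  qed
  have ng: "n \<cdot> g \<in> M" using M_comp[OF M_iso[OF g(6)] n] g by simp
  have nga: "(n \<cdot> g) \<cdot> a i = m i" if i: "i \<in> I" for i
    unfolding hb[OF i, symmetric] using b[OF i] g h(2,3) n by (simp add: assoc comp_assoc_cancel)
  have "is_union I a (Ident C X)"
  proof (rule is_union_IdentI[OF X a])
    fix u assume u: "u \<in> M" "Cod C u = X" and le: "\<And>i. i \<in> I \<Longrightarrow> factors (a i) u"
    \<comment> \<open>The image in \<open>A\<close> of a bound \<open>u\<close> of the
      \<open>a i\<close> is a bound of the \<open>m i\<close>, so \<open>n\<close> factors through
      it. Cancelling the monic \<open>n \<cdot> g\<close> then leaves a right inverse of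
      \<open>u\<close>.\<close>
    let ?w = "(n \<cdot> g) \<cdot> u"
    have w: "?w \<in> M" "Dom C ?w = Dom C u" "Cod C ?w = Cod C n"
      using M_comp[OF u(1) ng] u g n by auto
    have "factors (m i) ?w" if i: "i \<in> I" for i
    proof -
      obtain k where k: "k \<in> Ar C" "Cod C k = Dom C u" "u \<cdot> k = a i"
        using le[OF i] by (rule factorsE)
      have "?w \<cdot> k = (n \<cdot> g) \<cdot> (u \<cdot> k)" using k u ng g n by (subst assoc) auto
      then show ?thesis using k w nga[OF i] by (intro factorsI[of k]) auto
    qed
    then have "factors n ?w" using un w unfolding is_union_def by blast
    then obtain k where k: "k \<in> Ar C" "Dom C k = Dom C n" "Cod C k = Dom C u" "?w \<cdot> k = n"
      using w(2) by (auto elim!: factorsE)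
    have "(n \<cdot> g) \<cdot> (u \<cdot> (k \<cdot> g)) = (?w \<cdot> k) \<cdot> g"
      using k(1-3) u g(2-4) n by (simp add: assoc)
    then have "(n \<cdot> g) \<cdot> (u \<cdot> (k \<cdot> g)) = (n \<cdot> g) \<cdot> Ident C X"
      using k(4) g(2-4) n by simp
    then have "u \<cdot> (k \<cdot> g) = Ident C X"
      by (rule M_cancel[OF ng]) (use k(1-3) u g(2-4) n X in auto)
    then show "factors (Ident C X) u"
      by (intro factorsI[of "k \<cdot> g"]) (use k(1-3) u g(2-4) n in auto)
  qed
  then show "(I, a) \<in> basic_covers C M X" unfolding basic_covers_iff[OF X] using a by blast
qed

end

section \<open>The Grothendieck topology\<close>

text \<open>In the clauses on isomorphisms and pullbacks \<open>X\<close> is replaced by the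
  codomain it equals, so no codomain equation is left to carry along.\<close>

lemma (in category) grothendieck_basisI:
  assumes cover: "\<And>X I a i. \<lbrakk>X \<in> Ob C; (I, a) \<in> K X; i \<in> I\<rbrakk> \<Longrightarrow> a i \<in> Ar C \<and> Cod C (a i) = X"
    and iso: "\<And>i a. is_iso C (a i) \<Longrightarrow> ({i}, a) \<in> K (Cod C (a i))"
    and pullback_ex: "\<And>I a g i. \<lbrakk>(I, a) \<in> K (Cod C g); g \<in> Ar C; i \<in> I\<rbrakk> \<Longrightarrow> \<exists>p q. is_pullback C (a i) g p q"
    and pullback: "\<And>I a g p b. \<lbrakk>(I, a) \<in> K (Cod C g); g \<in> Ar C; \<And>i. i \<in> I \<Longrightarrow> is_pullback C (a i) g (p i) (b i)\<rbrakk>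
      \<Longrightarrow> (I, b) \<in> K (Dom C g)"
    and comp: "\<And>X I a J b L \<sigma> c. \<lbrakk>X \<in> Ob C; (I, a) \<in> K X; \<And>i. i \<in> I \<Longrightarrow> (J i, b i) \<in> K (Dom C (a i));
      bij_betw \<sigma> L (Sigma I J); \<And>l i j. \<lbrakk>l \<in> L; \<sigma> l = (i, j)\<rbrakk> \<Longrightarrow> c l = a i \<cdot> b i j\<rbrakk>
      \<Longrightarrow> (L, c) \<in> K X"
  shows "grothendieck_basis C K"
  unfolding grothendieck_basis_def Ball_def split_paired_All prod.case
proof (intro conjI allI impI; (elim conjE)?)
  show "a i \<in> Ar C" "Cod C (a i) = X" if "X \<in> Ob C" "(I, a) \<in> K X" "i \<in> I" for X I a i
    using cover that by blast+
  show "({i}, a) \<in> K X" if "is_iso C (a i)" "Cod C (a i) = X" for X i a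
    using iso that by blast
  show "\<exists>p q. is_pullback C (a i) g p q"
    if "(I, a) \<in> K X" "g \<in> Ar C" "Cod C g = X" "i \<in> I" for X I a g i
    using pullback_ex that by blast
  show "(I, b) \<in> K (Dom C g)"
    if "(I, a) \<in> K X" "g \<in> Ar C" "Cod C g = X" "\<forall>i. i \<in> I \<longrightarrow> is_pullback C (a i) g (p i) (b i)"
    for X I a g p b
    using pullback[of I a g p b] that by simp
  show "(L, c) \<in> K X"
    if "X \<in> Ob C" "(I, a) \<in> K X" "\<forall>i. i \<in> I \<longrightarrow> (J i, b i) \<in> K (Dom C (a i))"
      "bij_betw \<sigma> L (Sigma I J)" "\<forall>l. l \<in> L \<longrightarrow> (\<forall>i j. \<sigma> l = (i, j) \<longrightarrow> c l = a i \<cdot> b i j)"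
    for X I a J b L \<sigma> c
    using comp[of X I a J b \<sigma> L c] that by blast
qed

lemma (in category) grothendieck_basisD:
  assumes "grothendieck_basis C K"
  shows "\<And>i a. is_iso C (a i) \<Longrightarrow> ({i}, a) \<in> K (Cod C (a i))"
    and "\<And>I a g i. \<lbrakk>(I, a) \<in> K (Cod C g); g \<in> Ar C; i \<in> I\<rbrakk> \<Longrightarrow> \<exists>p q. is_pullback C (a i) g p q"
    and "\<And>I a g p b. \<lbrakk>(I, a) \<in> K (Cod C g); g \<in> Ar C; \<And>i. i \<in> I \<Longrightarrow> is_pullback C (a i) g (p i) (b i)\<rbrakk>
      \<Longrightarrow> (I, b) \<in> K (Dom C g)"
    and "\<And>X I a J b L \<sigma> c. \<lbrakk>X \<in> Ob C; (I, a) \<in> K X; \<And>i. i \<in> I \<Longrightarrow> (J i, b i) \<in> K (Dom C (a i));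
      bij_betw \<sigma> L (Sigma I J); \<And>l i j. \<lbrakk>l \<in> L; \<sigma> l = (i, j)\<rbrakk> \<Longrightarrow> c l = a i \<cdot> b i j\<rbrakk>
      \<Longrightarrow> (L, c) \<in> K X"
proof -
  note K = assms[unfolded grothendieck_basis_def Ball_def split_paired_All prod.case]
  note K1 = conjunct1[OF conjunct2[OF K]]
    and K2 = conjunct1[OF conjunct2[OF conjunct2[OF K]]] and K3 = conjunct2[OF conjunct2[OF conjunct2[OF K]]]
  show "({i}, a) \<in> K (Cod C (a i))" if "is_iso C (a i)" for i a
    using K1 that by (auto simp: is_iso_def)
  show "\<exists>p q. is_pullback C (a i) g p q" if "(I, a) \<in> K (Cod C g)" "g \<in> Ar C" "i \<in> I" for I a g i
    using K2 that Cod_Ob by blast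
  show "(I, b) \<in> K (Dom C g)"
    if "(I, a) \<in> K (Cod C g)" "g \<in> Ar C" "\<And>i. i \<in> I \<Longrightarrow> is_pullback C (a i) g (p i) (b i)" for I a g p b
    using K2[rule_format, THEN conjunct2, rule_format, OF Cod_Ob that(1,2) refl that(3)] that(2) .
  show "(L, c) \<in> K X"
    if "X \<in> Ob C" "(I, a) \<in> K X" "\<And>i. i \<in> I \<Longrightarrow> (J i, b i) \<in> K (Dom C (a i))"
      "bij_betw \<sigma> L (Sigma I J)" "\<And>l i j. \<lbrakk>l \<in> L; \<sigma> l = (i, j)\<rbrakk> \<Longrightarrow> c l = a i \<cdot> b i j"
    for X I a J b L \<sigma> c
    by (rule K3[rule_format, OF that(1,2) that(3)]) (use that(4,5) in auto)
qed

lemma (in geometric_M_category) grothendieck_basis_basic_covers: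
  "grothendieck_basis C (basic_covers C M :: 'o \<Rightarrow> ('i set \<times> ('i \<Rightarrow> 'a)) set)"
proof (rule grothendieck_basisI)
  fix X and I :: "'i set" and a i assume "X \<in> Ob C" "(I, a) \<in> basic_covers C M X" "i \<in> I"
  then show "a i \<in> Ar C \<and> Cod C (a i) = X" by (auto simp: basic_covers_iff)
next
  fix i :: 'i and a assume a: "is_iso C (a i)"
  then have aM: "a i \<in> M" by (simp add: M_iso)
  then have X: "Cod C (a i) \<in> Ob C" by simp
  have "is_union {i} a (Ident C (Cod C (a i)))"
  proof (rule is_union_IdentI[OF X])
    fix u assume u: "u \<in> M" "\<And>j. j \<in> {i} \<Longrightarrow> factors (a j) u"
    \<comment> \<open>The identity factors through an isomorphism by its inverse, so a bound of the
      single leg also bounds the identity.\<close>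
    have "factors (Ident C (Cod C (a i))) (a i)"
      using factors_iso(2)[OF a, of "Ident C (Cod C (a i))"] aM X by simp
    then show "factors (Ident C (Cod C (a i))) u" using factors_trans u by auto
  qed (use aM in auto)
  then show "({i}, a) \<in> basic_covers C M (Cod C (a i))" using aM by (simp add: basic_covers_iff X)
next
  fix I :: "'i set" and a g assume Ia: "(I, a) \<in> basic_covers C M (Cod C g)" and g: "g \<in> Ar C"
  then have X: "Cod C g \<in> Ob C" by simp
  have a: "\<And>i. i \<in> I \<Longrightarrow> a i \<in> M \<and> Cod C (a i) = Cod C g" and un: "is_union I a (Ident C (Cod C g))"
    using Ia unfolding basic_covers_iff[OF X] by auto
  show "\<exists>p q. is_pullback C (a i) g p q" if "i \<in> I" for i
    using M_pullback[of "a i" g] a[OF that] g by auto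
  show "(I, b) \<in> basic_covers C M (Dom C g)"
    if pb: "\<And>i. i \<in> I \<Longrightarrow> is_pullback C (a i) g (p i) (b i)" for p b
  proof -
    have "b i \<in> M \<and> Cod C (b i) = Dom C g" if "i \<in> I" for i
      using pullback_M[OF pb[OF that]] is_pullbackD(8)[OF pb[OF that]] a[OF that] by simp
    then show ?thesis
      using is_union_Ident_pullback[OF a g un pb] g by (auto simp: basic_covers_iff)
  qed
next
  fix X I a and J :: "'i \<Rightarrow> 'i set" and b L \<sigma> c
  assume X: "X \<in> Ob C" and Ia: "(I, a) \<in> basic_covers C M X"
    and Jb: "\<And>i. i \<in> I \<Longrightarrow> (J i, b i) \<in> basic_covers C M (Dom C (a i))"
    and \<sigma>: "bij_betw \<sigma> L (Sigma I J)"
    and c: "\<And>l i j. \<lbrakk>l \<in> L; \<sigma> l = (i, j)\<rbrakk> \<Longrightarrow> c l = a i \<cdot> b i j"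
  have a: "\<And>i. i \<in> I \<Longrightarrow> a i \<in> M \<and> Cod C (a i) = X" and ua: "is_union I a (Ident C X)"
    using Ia unfolding basic_covers_iff[OF X] by auto
  have b: "\<And>i j. \<lbrakk>i \<in> I; j \<in> J i\<rbrakk> \<Longrightarrow> b i j \<in> M \<and> Cod C (b i j) = Dom C (a i)"
    and ub: "\<And>i. i \<in> I \<Longrightarrow> is_union (J i) (b i) (Ident C (Dom C (a i)))"
    using Jb a by (auto simp: basic_covers_iff)
  have cM: "c l \<in> M \<and> Cod C (c l) = X" if l: "l \<in> L" for l
  proof -
    obtain i j where "\<sigma> l = (i, j)" "i \<in> I" "j \<in> J i"
      using bij_betwE[OF \<sigma>] l by blast
    then show ?thesis using c l a[of i] b[of i j] M_comp[of "b i j" "a i"] by auto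
  qed
  have ab: "\<exists>l \<in> L. c l = a i \<cdot> b i j" if "i \<in> I" "j \<in> J i" for i j
  proof -
    have "(i, j) \<in> \<sigma> ` L" using bij_betw_imp_surj_on[OF \<sigma>] that by blast
    then show ?thesis using c by force
  qed
  have "is_union L c (Ident C X)"
    by (rule is_union_Ident_trans[OF X a b ua ub cM ab])
  then show "(L, c) \<in> basic_covers C M X" using cM by (simp add: basic_covers_iff X)
qed

text \<open>The transitivity axiom composes a basic cover with basic covers chosen inside the pulled
  back sieves. The composites are indexed by pairs, and an infinite index type has room for
  them.\<close>

lemma (in category) basis_generates_topology:
  fixes K :: "'o \<Rightarrow> ('i set \<times> ('i \<Rightarrow> 'a)) set"
  assumes K: "grothendieck_basis C K" and inf: "infinite (UNIV :: 'i set)"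
  shows "grothendieck_topology C (\<lambda>X. {S. sieve C X S \<and> (\<exists>(I, a) \<in> K X. a ` I \<subseteq> S)})"
    (is "grothendieck_topology C ?J")
proof -
  have sieve_max: "sieve C X {f \<in> Ar C. Cod C f = X}" for X
    by (auto simp: sieve_def)
  have sieve_pull: "sieve C (Dom C h) (pull_sieve C h S)"
    if "sieve C X S" "h \<in> Ar C" for X S h
    using that by (auto simp: sieve_def pull_sieve_def simp flip: assoc)
  have max: "{f \<in> Ar C. Cod C f = X} \<in> ?J X" if X: "X \<in> Ob C" for X
  proof -
    \<comment> \<open>A one-element family may sit at any index; \<open>undefined\<close> merely
      names one.\<close>
    have "({undefined}, \<lambda>_. Ident C X) \<in> K X"
      using grothendieck_basisD(1)[OF K, of "\<lambda>_. Ident C X" undefined] X iso_Ident by simp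
    moreover have "(\<lambda>_. Ident C X) ` {undefined :: 'i} \<subseteq> {f \<in> Ar C. Cod C f = X}" using X by simp
    ultimately show ?thesis using sieve_max by blast
  qed
  have stable: "pull_sieve C h S \<in> ?J (Dom C h)"
    if X: "X \<in> Ob C" and S: "S \<in> ?J X" and h: "h \<in> Ar C" "Cod C h = X" for X S h
  proof -
    obtain I a where Ia: "(I, a) \<in> K X" "a ` I \<subseteq> S" and sS: "sieve C X S" using S by blast
    obtain p b where pb: "\<And>i. i \<in> I \<Longrightarrow> is_pullback C (a i) h (p i) (b i)"
      using grothendieck_basisD(2)[OF K, of I a h] Ia(1) h by metis
    then have "(I, b) \<in> K (Dom C h)" using grothendieck_basisD(3)[OF K, of I a h p b] Ia(1) h by simp
    moreover have "b i \<in> pull_sieve C h S" if i: "i \<in> I" for i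
    proof -
      note pq = is_pullbackD[OF pb[OF i]]
      \<comment> \<open>This composite equals \<open>h \<cdot> b i\<close>, which is what membership
        of \<open>b i\<close> in the pulled back sieve asks for.\<close>
      have "a i \<cdot> p i \<in> S" using sS Ia(2) i pq unfolding sieve_def by blast
      then show ?thesis using pq by (simp add: pull_sieve_def)
    qed
    ultimately show ?thesis using sieve_pull[OF sS h(1)] by blast
  qed
  have trans: "R \<in> ?J X" if X: "X \<in> Ob C" and S: "S \<in> ?J X" and R: "sieve C X R"
    and local: "\<forall>h \<in> S. pull_sieve C h R \<in> ?J (Dom C h)" for X S R
  proof -
    obtain I a where Ia: "(I, a) \<in> K X" "a ` I \<subseteq> S" using S by blast
    have "\<forall>i. \<exists>J b. i \<in> I \<longrightarrow> (J, b) \<in> K (Dom C (a i)) \<and> b ` J \<subseteq> pull_sieve C (a i) R"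
      using local Ia(2) by blast
    then obtain J b where Jb: "\<And>i. i \<in> I \<Longrightarrow> (J i, b i) \<in> K (Dom C (a i)) \<and> b i ` J i \<subseteq> pull_sieve C (a i) R"
      by metis
    \<comment> \<open>An infinite type is in bijection with its square. The image of
      \<open>Sigma I J\<close> under \<phi> becomes the index set, and the inverse recovers the
      pairs.\<close>
    obtain \<phi> :: "'i \<times> 'i \<Rightarrow> 'i" where \<phi>: "bij_betw \<phi> (UNIV \<times> UNIV) UNIV"
      using card_of_Times_same_infinite[OF inf] card_of_ordIso by blast
    then have "inj_on \<phi> (Sigma I J)" unfolding bij_betw_def by (blast intro: inj_on_subset)
    then have \<sigma>: "bij_betw (inv_into (Sigma I J) \<phi>) (\<phi> ` Sigma I J) (Sigma I J)"
      by (intro bij_betw_inv_into inj_on_imp_bij_betw)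
    define c where "c l = (case inv_into (Sigma I J) \<phi> l of (i, j) \<Rightarrow> a i \<cdot> b i j)" for l
    have "(\<phi> ` Sigma I J, c) \<in> K X"
      by (rule grothendieck_basisD(4)[OF K X Ia(1) _ \<sigma>]) (use Jb in \<open>auto simp: c_def\<close>)
    moreover have "c l \<in> R" if l: "l \<in> \<phi> ` Sigma I J" for l
    proof -
      obtain i j where "inv_into (Sigma I J) \<phi> l = (i, j)" "i \<in> I" "j \<in> J i"
        using bij_betwE[OF \<sigma>] l by blast
      moreover from this have "a i \<cdot> b i j \<in> R" using Jb[of i] unfolding pull_sieve_def by blast
      ultimately show ?thesis by (simp add: c_def)
    qed
    ultimately show ?thesis using R by blast
  qed
  show ?thesis
    unfolding grothendieck_topology_def
  proof (intro conjI ballI allI impI)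
    show "sieve C X S" if "S \<in> ?J X" for X S using that by simp
    show "{f \<in> Ar C. Cod C f = X} \<in> ?J X" if "X \<in> Ob C" for X using that by (rule max)
    show "pull_sieve C h S \<in> ?J (Dom C h)"
      if "X \<in> Ob C" "S \<in> ?J X" "h \<in> Ar C" "Cod C h = X" for X S h using that by (rule stable)
    show "R \<in> ?J X"
      if "X \<in> Ob C" "S \<in> ?J X" "sieve C X R \<and> (\<forall>h \<in> S. pull_sieve C h R \<in> ?J (Dom C h))" for X S R
      by (rule trans[OF that(1,2)]) (use that(3) in blast)+
  qed
qed

theorem proposition16:
  fixes C :: "('o, 'a) cat_struct" and M :: "'a set"
    and K :: "'o \<Rightarrow> ('i set \<times> ('i \<Rightarrow> 'a)) set"
  assumes "geometric_M_category C M"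
    and "infinite (UNIV :: 'i set)"
    and "K = basic_covers C M"
  shows "(\<exists>J. grothendieck_topology C J \<and> is_basis_for C K J) \<and>
    (\<forall>X \<in> Ob C. \<forall>(I :: 'i set) a.
      (I, a) \<in> K X \<longleftrightarrow>
      (\<exists>A \<in> Ob C. \<exists>m. (\<forall>i \<in> I. m i \<in> M \<and> Dom C (m i) = Dom C (a i) \<and> Cod C (m i) = A) \<and>
         colimit_of_matching_diagram C I m X a))"
proof -
  interpret geometric_M_category C M by (rule assms(1))
  have basis: "grothendieck_basis C K"
    using grothendieck_basis_basic_covers assms(3) by simp
  \<comment> \<open>On objects the witness is forced: \<open>is_basis_for\<close> prescribes the
    sieves that contain a basic cover.\<close>
  then have "is_basis_for C K (\<lambda>X. {S. sieve C X S \<and> (\<exists>(I, a) \<in> K X. a ` I \<subseteq> S)})"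
    by (simp add: is_basis_for_def)
  then show ?thesis
    using basis_generates_topology[OF basis assms(2)] basic_cover_iff_colimit assms(3) by blast
qed

end
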